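(* For every fixed positive integer $n$ and every real $\varepsilon\in(0,1)$, there exists $k_0=k_0(n,\varepsilon)$ such that $$M_k(n)\le n\lceil(1+\varepsilon)k\rceil\qquad\text{for every integer } k\ge k_0.$$ Consequently, for every fixed positive integer $n$, $M_k(n)=(1+o(1))nk$ as $k\to\infty$, i.e. $\lim_{k\to\infty}M_k(n)/(nk)=1$.
   Context: For a positive integer $m$, $[m]=\{1,2,\ldots,m\}$. For $A\subseteq\mathbb{Z}$ and $t\in\mathbb{Z}$, $t+A=\{t+a:a\in A\}$ is called a translate of $A$. Given a positive integer $n$, put $B_d=\{d,2d,\ldots,nd\}$ for each positive integer $d$. For positive integers $k,n$, $M_k(n)$ is the least positive integer $m$ for which there exist integers $t_1,\ldots,t_k$ such that $t_d+B_d\subseteq[m]$ for all $d\in[k]$ and the sets $t_1+B_1,\ldots,t_k+B_k$ are pairwise disjoint. *)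

theory Defs
  imports "HOL-Analysis.Analysis"
begin

definition translate :: "int \<Rightarrow> int set \<Rightarrow> int set" where
  "translate t A = (\<lambda>a. t + a) ` A"

definition B :: "nat \<Rightarrow> nat \<Rightarrow> int set" where
  "B n d = (\<lambda>j. int j * int d) ` {1..n}"

text \<open>The translation vectors \<open>t\<close> are total functions; only the values \<open>t 1, \<dots>, t k\<close> matter.\<close>

definition packs :: "nat \<Rightarrow> nat \<Rightarrow> nat \<Rightarrow> (nat \<Rightarrow> int) \<Rightarrow> bool" where
  "packs k n m t \<longleftrightarrow>
     (\<forall>d\<in>{1..k}. translate (t d) (B n d) \<subseteq> {1..int m}) \<and>
     disjoint_family_on (\<lambda>d. translate (t d) (B n d)) {1..k}"

definition M :: "nat \<Rightarrow> nat \<Rightarrow> nat" where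
  "M k n = (LEAST m. m > 0 \<and> (\<exists>t. packs k n m t))"

text \<open>Some length always admits a packing, so the \<open>LEAST\<close> in \<open>M\<close> is attained: place the \<open>k\<close>
  progressions into consecutive blocks of length \<open>n * k\<close>.\<close>

lemma packs_exists:
  assumes "n > 0" "k > 0"
  shows "\<exists>m>0. \<exists>t. packs k n m t"
proof -
  define L where "L = int n * int k"
  define t where "t d = (int d - 1) * L" for d
  have sub: "x > (int d - 1) * L \<and> x \<le> int d * L"
    if d: "d \<in> {1..k}" and x: "x \<in> translate (t d) (B n d)" for d x
  proof -
    obtain j where j: "j \<in> {1..n}" "x = t d + int j * int d"
      using x by (auto simp: translate_def B_def)
    have "int j * int d \<le> L"
      unfolding L_def using j(1) d by (intro mult_mono) auto
    moreover have "int j * int d > 0" using j(1) d by simp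
    ultimately show ?thesis using j(2) by (simp add: t_def algebra_simps)
  qed
  have L0: "L \<ge> 0" by (simp add: L_def)
  have "packs k n (k * n * k) t"
    unfolding packs_def
  proof (intro conjI ballI subsetI)
    fix d x assume d: "d \<in> {1..k}" and x: "x \<in> translate (t d) (B n d)"
    have "int d * L \<le> int k * L" using d L0 by (intro mult_right_mono) auto
    moreover have "(int d - 1) * L \<ge> 0" using d L0 by auto
    ultimately show "x \<in> {1..int (k * n * k)}"
      using sub[OF d x] by (auto simp: L_def mult.assoc)
  next
    have less: "x < y" if "d \<in> {1..k}" "e \<in> {1..k}" "d < e"
      "x \<in> translate (t d) (B n d)" "y \<in> translate (t e) (B n e)" for d e x y
    proof -
      have "int d * L \<le> (int e - 1) * L" using that(3) L0 by (intro mult_right_mono) auto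
      then show ?thesis using sub[OF that(1,4)] sub[OF that(2,5)] by linarith
    qed
    show "disjoint_family_on (\<lambda>d. translate (t d) (B n d)) {1..k}"
      unfolding disjoint_family_on_def
    proof (intro ballI impI equals0I)
      fix d e x assume "d \<in> {1..k}" "e \<in> {1..k}" "d \<noteq> e"
        and "x \<in> translate (t d) (B n d) \<inter> translate (t e) (B n e)"
      then show False using less[of d e x x] less[of e d x x] by (cases d e rule: linorder_cases) auto
    qed
  qed
  moreover have "k * n * k > 0" using assms by simp
  ultimately show ?thesis by blast
qed

end

theory Submission
  imports Defs "HOL-Number_Theory.Cong"
begin

text \<open>
  Write \<open>ap n d t\<close> for the progression \<open>t, t + d, \<dots>, t + (n - 1) d\<close>. Packing one progression for
  each \<open>d \<le> k\<close> is a matching problem in the hypergraph whose vertices are the differences and the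
  points, with one edge \<open>{d} \<union> ap n d t\<close> for each possible placement. The proof finds an almost
  perfect \<^emph>\<open>fractional\<close> packing that is spread out, rounds it, and repairs the few failures in
  space set aside for them.

  \<^bold>\<open>The fractional packing.\<close> An interval of length \<open>n d\<close> is tiled by the \<open>d\<close> progressions of difference
  \<open>d\<close> that start in its first \<open>d\<close> points. Hence a random partition of an interval of length \<open>L\<close> into
  pieces, scaled by \<open>n\<close>, gives a fractional packing: a piece of length \<open>d\<close> is filled with all \<open>d\<close>
  of these progressions. Every point is then covered exactly once, and \<open>d\<close> is used with total
  weight \<open>1\<close> provided that the expected number of pieces of length \<open>d\<close> is \<open>1 / d\<close>. This is the
  cycle statistic of a uniform random permutation, and stick breaking realises it: cut off a piece
  of uniform length from the left, and repeat on the rest (\<open>sum_piece_prob\<close>). The differences above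
  \<open>k\<close> and those up to a small multiple \<open>g\<close> of \<open>k\<close> are left out of it; omitting them leaves a positive
  proportion of free space at every point (\<open>sum_cover_le\<close>).

  \<^bold>\<open>The reserve.\<close> Fix large, pairwise coprime \<open>p\<^sub>0, \<dots>, p\<^sub>n\<^sub>-\<^sub>1\<close> and let \<open>R\<close> be the set of points divisible
  by some \<open>p\<^sub>i\<close>. It is sparse, yet by the Chinese remainder theorem every \<open>d\<close> has a positive density
  of \<open>t\<close> with \<open>p\<^sub>i\<close> dividing \<open>t + i d\<close> for every \<open>i\<close>, so that the whole progression lies in \<open>R\<close>
  (\<open>many_starts_in_multiples\<close>). Forbidding \<open>R\<close> costs each difference only a small part of its weight,
  and rescaling the rest is paid for by the free space above.

  \<^bold>\<open>Rounding.\<close> All pair codegrees of the resulting weighting are \<open>O(1 / k)\<close>, so a weighted form of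
  the theorem of Pippenger and of Frankl and Roedl applies (\<open>near_perfect_matching\<close>). Instead of a
  random nibble the proof here is a deterministic flow in continuous time. Each surviving edge \<open>e\<close> carries the
  weight \<open>w(e) exp(\<theta> (|e| - 1))\<close>, which compensates at time \<open>\<theta>\<close> for the loss of edges if vertices
  survive with probability \<open>exp(-\<theta>)\<close>. A potential combines the number of surviving vertices with
  the sum of the squares \<open>(deg v - 1)\<^sup>2\<close>. At each moment, either some edge can be
  put into the matching without increasing the potential, or, if there is none, the potential
  decreases exponentially as time passes, up to a small error. The number of unmatched vertices at
  the end is bounded by the potential.

  \<^bold>\<open>Repair.\<close> The few unmatched differences above \<open>g\<close> are placed greedily in \<open>R\<close>, and all differences up to
  \<open>g\<close> greedily in a short final segment.
\<close>

section \<open>Drift of the degree deviations in a weighted hypergraph\<close>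

locale weighted_hypergraph =
  fixes U :: "'v set" and J :: "'i set" and ed :: "'i \<Rightarrow> 'v set" and w :: "'i \<Rightarrow> real"
    and r :: nat and b \<kappa> :: real
  assumes finite_U: "finite U" and finite_J: "finite J"
    and ed_sub: "i \<in> J \<Longrightarrow> ed i \<subseteq> U"
    and ed_card: "i \<in> J \<Longrightarrow> card (ed i) \<le> r"
    and w_nonneg: "i \<in> J \<Longrightarrow> 0 \<le> w i"
    and deg_le: "v \<in> U \<Longrightarrow> (\<Sum>i | i \<in> J \<and> v \<in> ed i. w i) \<le> b"
    and b_ge1: "1 \<le> b"
    and \<kappa>_nonneg: "0 \<le> \<kappa>"
    and codeg_le: "u \<in> U \<Longrightarrow> v \<in> U \<Longrightarrow> u \<noteq> v \<Longrightarrow>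
        (\<Sum>i | i \<in> J \<and> u \<in> ed i \<and> v \<in> ed i. w i) \<le> \<kappa>"
begin

definition deg :: "'v \<Rightarrow> real" where
  "deg v = (\<Sum>i | i \<in> J \<and> v \<in> ed i. w i)"

text \<open>\<open>growth v\<close> is the time derivative of \<open>deg v\<close> when each weight \<open>w e\<close> grows at the rate
\<open>|e| - 1\<close>. \<open>loss e v\<close> is what \<open>v\<close> loses if the vertices of \<open>e\<close> are deleted, and \<open>hit v f\<close> is the
rate at which \<open>f\<close> is destroyed by edges that spare \<open>v\<close>, if each edge \<open>e\<close> is chosen at rate \<open>w e\<close>.\<close>

definition growth :: "'v \<Rightarrow> real" where
  "growth v = (\<Sum>i | i \<in> J \<and> v \<in> ed i. w i * (real (card (ed i)) - 1))"

definition loss :: "'i \<Rightarrow> 'v \<Rightarrow> real" where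
  "loss e v = (\<Sum>f | f \<in> J \<and> (v \<in> ed f \<and> ed f \<inter> ed e \<noteq> {}). w f)"

definition hit :: "'v \<Rightarrow> 'i \<Rightarrow> real" where
  "hit v f = (\<Sum>e | e \<in> J \<and> (v \<notin> ed e \<and> ed f \<inter> ed e \<noteq> {}). w e)"

definition expected_loss :: "'v \<Rightarrow> real" where
  "expected_loss v = (\<Sum>e | e \<in> J \<and> v \<notin> ed e. w e * loss e v)"

abbreviation dev :: "'v \<Rightarrow> real" where
  "dev v \<equiv> deg v - 1"

lemma finite_ed: "i \<in> J \<Longrightarrow> finite (ed i)"
  using ed_sub finite_U finite_subset by blast

lemma deg_nonneg: "0 \<le> deg v"
  unfolding deg_def by (rule sum_nonneg) (use w_nonneg in auto)

lemma deg_le_b: "v \<in> U \<Longrightarrow> deg v \<le> b"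
  unfolding deg_def by (rule deg_le)

lemma abs_dev_le: "v \<in> U \<Longrightarrow> \<bar>dev v\<bar> \<le> b"
  using deg_nonneg[of v] deg_le_b[of v] b_ge1 by linarith

lemma loss_nonneg: "0 \<le> loss e v"
  unfolding loss_def by (rule sum_nonneg) (use w_nonneg in auto)

lemma sum_deg_swap:
  "(\<Sum>v\<in>U. deg v * c v) = (\<Sum>i\<in>J. w i * (\<Sum>v\<in>ed i. c v))"
proof -
  have "(\<Sum>v\<in>U. deg v * c v) = (\<Sum>v\<in>U. \<Sum>i | i \<in> J \<and> v \<in> ed i. w i * c v)"
    by (simp add: deg_def sum_distrib_right)
  also have "\<dots> = (\<Sum>i\<in>J. \<Sum>v | v \<in> U \<and> v \<in> ed i. w i * c v)"
    by (rule sum.swap_restrict[OF finite_U finite_J])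
  also have "\<dots> = (\<Sum>i\<in>J. w i * (\<Sum>v\<in>ed i. c v))"
  proof (rule sum.cong[OF refl])
    fix i assume "i \<in> J"
    then have "{v. v \<in> U \<and> v \<in> ed i} = ed i" using ed_sub by auto
    then show "(\<Sum>v | v \<in> U \<and> v \<in> ed i. w i * c v) = w i * (\<Sum>v\<in>ed i. c v)"
      by (simp add: sum_distrib_left)
  qed
  finally show ?thesis .
qed


lemma sum_filter_of_bool:
  fixes h :: "'i \<Rightarrow> real"
  shows "sum h {i \<in> J. P i} = (\<Sum>i\<in>J. h i * of_bool (P i))"
  by (simp add: sum.inter_filter[OF finite_J] of_bool_def if_distrib cong: if_cong)

lemma loss_le:
  assumes "e \<in> J" "v \<in> U" "v \<notin> ed e"
  shows "loss e v \<le> real r * \<kappa>"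
proof -
  have fin: "finite (ed e)" by (rule finite_ed) fact
  have "loss e v = (\<Sum>f\<in>J. w f * of_bool (v \<in> ed f \<and> ed f \<inter> ed e \<noteq> {}))"
    unfolding loss_def by (rule sum_filter_of_bool)
  also have "\<dots> \<le> (\<Sum>f\<in>J. \<Sum>u\<in>ed e. w f * of_bool (u \<in> ed f \<and> v \<in> ed f))"
  proof (rule sum_mono)
    fix f assume f: "f \<in> J"
    have "(of_bool (v \<in> ed f \<and> ed f \<inter> ed e \<noteq> {}) :: real) \<le> (\<Sum>u\<in>ed e. of_bool (u \<in> ed f \<and> v \<in> ed f))"
    proof (cases "v \<in> ed f \<and> ed f \<inter> ed e \<noteq> {}")
      case True
      then obtain u where u: "u \<in> ed e" "u \<in> ed f" by blast
      have "(of_bool (u \<in> ed f \<and> v \<in> ed f) :: real) \<le> (\<Sum>u\<in>ed e. of_bool (u \<in> ed f \<and> v \<in> ed f))"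
        by (rule member_le_sum[OF u(1)]) (use fin in auto)
      then show ?thesis using True u by simp
    qed (auto intro: sum_nonneg)
    then show "w f * of_bool (v \<in> ed f \<and> ed f \<inter> ed e \<noteq> {}) \<le> (\<Sum>u\<in>ed e. w f * of_bool (u \<in> ed f \<and> v \<in> ed f))"
      unfolding sum_distrib_left[symmetric] by (rule mult_left_mono) (rule w_nonneg[OF f])
  qed
  also have "\<dots> = (\<Sum>u\<in>ed e. sum w {f \<in> J. u \<in> ed f \<and> v \<in> ed f})"
    unfolding sum_filter_of_bool by (rule sum.swap)
  also have "\<dots> \<le> (\<Sum>u\<in>ed e. \<kappa>)"
    by (rule sum_mono, rule codeg_le) (use assms ed_sub in auto)
  also have "\<dots> \<le> real r * \<kappa>"
    using ed_card[OF assms(1)] \<kappa>_nonneg by (simp add: mult_right_mono)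
  finally show ?thesis .
qed

lemma sum_deg_of_bool:
  "(\<Sum>u\<in>A. deg u) = (\<Sum>e\<in>J. w e * (\<Sum>u\<in>A. of_bool (u \<in> ed e)))"
  unfolding deg_def sum_filter_of_bool sum_distrib_left by (rule sum.swap)

text \<open>Up to codegrees, an edge \<open>f\<close> is hit at the sum of the rates at which its vertices other than \<open>v\<close>
are hit: only edges that meet \<open>f\<close> twice are counted incorrectly. This lemma and \<open>hit_ge\<close> are the two
halves.\<close>

lemma hit_le:
  assumes f: "f \<in> J" and v: "v \<in> ed f"
  shows "hit v f \<le> (\<Sum>u\<in>ed f - {v}. deg u)"
  unfolding sum_deg_of_bool hit_def sum_filter_of_bool
proof (rule sum_mono, rule mult_left_mono)
  fix e assume e: "e \<in> J"
  show "0 \<le> w e" by (rule w_nonneg[OF e])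
  have fin: "finite (ed f - {v})" using finite_ed[OF f] by simp
  show "of_bool (v \<notin> ed e \<and> ed f \<inter> ed e \<noteq> {}) \<le> (\<Sum>u\<in>ed f - {v}. of_bool (u \<in> ed e) :: real)"
  proof (cases "v \<notin> ed e \<and> ed f \<inter> ed e \<noteq> {}")
    case True
    then obtain u where u: "u \<in> ed f - {v}" "u \<in> ed e" by blast
    have "(of_bool (u \<in> ed e) :: real) \<le> (\<Sum>u\<in>ed f - {v}. of_bool (u \<in> ed e))"
      by (rule member_le_sum[OF u(1)]) (use fin in auto)
    then show ?thesis using True u by simp
  qed (auto intro: sum_nonneg)
qed

text \<open>With \<open>a = |A \<inter> C|\<close> the double sum is \<open>a (a - 1)\<close>, so the claim is \<open>a \<le> 1 + a (a - 1)\<close> for a set \<open>C\<close>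
that avoids \<open>v\<close> and meets \<open>A\<close>, and \<open>a - 1 \<le> a (a - 1)\<close> for one that contains \<open>v\<close>.\<close>

lemma card_inter_le_hit_plus_pairs:
  fixes A C :: "'v set"
  assumes A: "finite A" and v: "v \<in> A"
  shows "(\<Sum>u\<in>A - {v}. of_bool (u \<in> C) :: real) \<le>
    of_bool (v \<notin> C \<and> A \<inter> C \<noteq> {}) + (\<Sum>u\<in>A. \<Sum>u'\<in>A - {u}. of_bool (u \<in> C \<and> u' \<in> C))"
proof -
  define a where "a = card (A \<inter> C)"
  have cnt: "(\<Sum>u\<in>D. of_bool (u \<in> C) :: real) = card (D \<inter> C)" if "finite D" for D
    using that by (simp add: of_bool_def sum.If_cases Int_commute)
  have drop1: "(\<Sum>u'\<in>A - {u}. of_bool (u' \<in> C) :: real) = real a - of_bool (u \<in> C)" if "u \<in> A" for u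
    using sum.remove[OF A that, of "\<lambda>u'. of_bool (u' \<in> C) :: real"] cnt[OF A] unfolding a_def by linarith
  have "(\<Sum>u\<in>A. \<Sum>u'\<in>A - {u}. of_bool (u \<in> C \<and> u' \<in> C)) =
      (\<Sum>u\<in>A. of_bool (u \<in> C) * (real a - 1))"
  proof (rule sum.cong[OF refl])
    fix u assume u: "u \<in> A"
    show "(\<Sum>u'\<in>A - {u}. of_bool (u \<in> C \<and> u' \<in> C)) = of_bool (u \<in> C) * (real a - 1)"
    proof (cases "u \<in> C")
      case True
      then show ?thesis using drop1[OF u] by simp
    qed simp
  qed
  also have "\<dots> = real a * (real a - 1)"
    using A by (simp add: sum_distrib_right[symmetric] cnt a_def)
  finally have pairs: "(\<Sum>u\<in>A. \<Sum>u'\<in>A - {u}. of_bool (u \<in> C \<and> u' \<in> C)) = real a * (real a - 1)" .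
  have lhs: "(\<Sum>u\<in>A - {v}. of_bool (u \<in> C) :: real) = real a - of_bool (v \<in> C)"
    by (rule drop1[OF v])
  have a0: "a = 0 \<longleftrightarrow> A \<inter> C = {}" using A by (simp add: a_def)
  have sq: "real a * (real a - 1) \<ge> real a - 1"
  proof (cases "a = 0")
    case False
    then have "0 \<le> (real a - 1) * (real a - 1)" by simp
    then show ?thesis by (simp add: algebra_simps)
  qed simp
  have sq0: "real a * (real a - 1) \<ge> 0" by (cases "a = 0") auto
  show ?thesis unfolding lhs pairs using a0 sq sq0 v by (cases "v \<in> C"; cases "a = 0") auto
qed

lemma hit_ge:
  assumes f: "f \<in> J" and v: "v \<in> ed f"
  shows "(\<Sum>u\<in>ed f - {v}. deg u) \<le> hit v f + real r * real r * \<kappa>"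
proof -
  have fin: "finite (ed f)" by (rule finite_ed[OF f])
  have "(\<Sum>u\<in>ed f - {v}. deg u) \<le> (\<Sum>e\<in>J. w e * (of_bool (v \<notin> ed e \<and> ed f \<inter> ed e \<noteq> {}) +
      (\<Sum>u\<in>ed f. \<Sum>u'\<in>ed f - {u}. of_bool (u \<in> ed e \<and> u' \<in> ed e))))"
    unfolding sum_deg_of_bool
    by (intro sum_mono mult_left_mono card_inter_le_hit_plus_pairs fin v w_nonneg)
  also have "\<dots> = hit v f + (\<Sum>e\<in>J. \<Sum>u\<in>ed f. \<Sum>u'\<in>ed f - {u}. w e * of_bool (u \<in> ed e \<and> u' \<in> ed e))"
    unfolding hit_def sum_filter_of_bool by (simp add: distrib_left sum.distrib sum_distrib_left)
  also have "(\<Sum>e\<in>J. \<Sum>u\<in>ed f. \<Sum>u'\<in>ed f - {u}. w e * of_bool (u \<in> ed e \<and> u' \<in> ed e)) =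
      (\<Sum>u\<in>ed f. \<Sum>u'\<in>ed f - {u}. sum w {e \<in> J. u \<in> ed e \<and> u' \<in> ed e})"
    unfolding sum_filter_of_bool by (subst sum.swap) (intro sum.cong refl sum.swap)
  also have "\<dots> \<le> (\<Sum>u\<in>ed f. \<Sum>u'\<in>ed f - {u}. \<kappa>)"
    using ed_sub[OF f] by (intro sum_mono codeg_le) auto
  also have "\<dots> \<le> (\<Sum>u\<in>ed f. real r * \<kappa>)"
  proof (rule sum_mono)
    fix u
    have "card (ed f - {u}) \<le> r" using ed_card[OF f] card_Diff1_le[of "ed f" u] by linarith
    then show "(\<Sum>u'\<in>ed f - {u}. \<kappa>) \<le> real r * \<kappa>" using \<kappa>_nonneg by (simp add: mult_right_mono)
  qed
  also have "\<dots> \<le> real r * (real r * \<kappa>)"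
    using ed_card[OF f] \<kappa>_nonneg by (simp add: mult_right_mono)
  finally show ?thesis by (simp add: mult.assoc)
qed

lemma expected_loss_eq: "expected_loss v = (\<Sum>f | f \<in> J \<and> v \<in> ed f. w f * hit v f)"
proof -
  have "expected_loss v = (\<Sum>e\<in>J. \<Sum>f\<in>J. w e * of_bool (v \<notin> ed e) *
      (w f * of_bool (v \<in> ed f \<and> ed f \<inter> ed e \<noteq> {})))"
    unfolding expected_loss_def loss_def sum_filter_of_bool sum_distrib_left sum_distrib_right
    by (intro sum.cong refl) (simp add: mult_ac)
  also have "\<dots> = (\<Sum>f\<in>J. \<Sum>e\<in>J. w e * of_bool (v \<notin> ed e) *
      (w f * of_bool (v \<in> ed f \<and> ed f \<inter> ed e \<noteq> {})))"
    by (rule sum.swap)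
  also have "\<dots> = (\<Sum>f | f \<in> J \<and> v \<in> ed f. w f * hit v f)"
    unfolding hit_def sum_filter_of_bool sum_distrib_left sum_distrib_right
    by (intro sum.cong refl) auto
  finally show ?thesis .
qed

lemma sum_deg_edge_le:
  assumes f: "f \<in> J"
  shows "(\<Sum>u\<in>ed f - {v}. deg u) \<le> real r * b"
proof -
  have "(\<Sum>u\<in>ed f - {v}. deg u) \<le> (\<Sum>u\<in>ed f - {v}. b)"
    using ed_sub[OF f] by (intro sum_mono deg_le_b) auto
  also have "\<dots> = real (card (ed f - {v})) * b" by simp
  also have "\<dots> \<le> real r * b"
  proof (rule mult_right_mono)
    have "card (ed f - {v}) \<le> r" using ed_card[OF f] card_Diff1_le[of "ed f" v] by linarith
    then show "real (card (ed f - {v})) \<le> real r" by simp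
  qed (use b_ge1 in simp)
  finally show ?thesis .
qed

text \<open>A single deletion removes at most \<open>r \<kappa>\<close> from the degree of a vertex that it spares, so the second
moment of the loss is at most \<open>r \<kappa>\<close> times the first moment. This is where small codegrees replace the
independence arguments of a random nibble.\<close>

lemma expected_loss_sq_le:
  assumes v: "v \<in> U"
  shows "(\<Sum>e | e \<in> J \<and> v \<notin> ed e. w e * (loss e v)\<^sup>2) \<le> (real r)\<^sup>2 * b\<^sup>2 * \<kappa>"
proof -
  have "(\<Sum>e | e \<in> J \<and> v \<notin> ed e. w e * (loss e v)\<^sup>2)
      \<le> (\<Sum>e | e \<in> J \<and> v \<notin> ed e. real r * \<kappa> * (w e * loss e v))"
  proof (rule sum_mono)
    fix e assume e: "e \<in> {e. e \<in> J \<and> v \<notin> ed e}"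
    have "loss e v * loss e v \<le> (real r * \<kappa>) * loss e v"
      by (rule mult_right_mono[OF loss_le loss_nonneg]) (use e v in auto)
    from mult_left_mono[OF this, of "w e"] w_nonneg[of e] e
    show "w e * (loss e v)\<^sup>2 \<le> real r * \<kappa> * (w e * loss e v)"
      by (simp add: power2_eq_square mult_ac)
  qed
  also have "\<dots> = real r * \<kappa> * expected_loss v"
    by (simp add: expected_loss_def sum_distrib_left)
  also have "\<dots> \<le> real r * \<kappa> * (\<Sum>f | f \<in> J \<and> v \<in> ed f. w f * (real r * b))"
    unfolding expected_loss_eq using \<kappa>_nonneg w_nonneg
    by (intro mult_left_mono sum_mono order_trans[OF hit_le sum_deg_edge_le]) auto
  also have "\<dots> = real r * \<kappa> * (deg v * (real r * b))"
    by (simp add: deg_def sum_distrib_right)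
  also have "\<dots> \<le> real r * \<kappa> * (b * (real r * b))"
    using \<kappa>_nonneg b_ge1 deg_le_b[OF v] by (intro mult_left_mono mult_right_mono) auto
  finally show ?thesis by (simp add: power2_eq_square mult_ac)
qed

text \<open>If all degrees were \<open>1\<close>, growth and expected loss would cancel up to codegrees. In general their
difference is minus the weighted sum of the deviations of the neighbours of \<open>v\<close>, and \<open>2 x y \<le> x\<^sup>2 + y\<^sup>2\<close> bounds
its product with \<open>dev v\<close> by squares, which can be summed over \<open>v\<close>.\<close>

lemma growth_minus_expected_loss:
  assumes v: "v \<in> U"
  shows "2 * dev v * (growth v - expected_loss v) \<le>
    (\<Sum>f | f \<in> J \<and> v \<in> ed f. w f * (\<Sum>u\<in>ed f - {v}. (dev v)\<^sup>2 + (dev u)\<^sup>2)) + 2 * (real r)\<^sup>2 * b\<^sup>2 * \<kappa>"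
proof -
  have "2 * dev v * (growth v - expected_loss v) =
      (\<Sum>f | f \<in> J \<and> v \<in> ed f. w f * (2 * dev v * ((real (card (ed f)) - 1) - hit v f)))"
    unfolding growth_def expected_loss_eq sum_subtractf[symmetric] sum_distrib_left
    by (intro sum.cong refl) (simp add: algebra_simps)
  also have "\<dots> \<le> (\<Sum>f | f \<in> J \<and> v \<in> ed f. w f * ((\<Sum>u\<in>ed f - {v}. (dev v)\<^sup>2 + (dev u)\<^sup>2) + 2 * b * (real r * real r * \<kappa>)))"
  proof (rule sum_mono, rule mult_left_mono)
    fix f assume "f \<in> {f. f \<in> J \<and> v \<in> ed f}"
    then have f: "f \<in> J" and vf: "v \<in> ed f" by auto
    show "0 \<le> w f" by (rule w_nonneg[OF f])
    define err where "err = (\<Sum>u\<in>ed f - {v}. deg u) - hit v f"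
    have err: "0 \<le> err" "err \<le> real r * real r * \<kappa>"
      using hit_le[OF f vf] hit_ge[OF f vf] by (auto simp: err_def)
    have c: "real (card (ed f)) - 1 = (\<Sum>u\<in>ed f - {v}. 1)"
      using finite_ed[OF f] vf by (simp add: card_Diff_singleton) 
        (metis One_nat_def Suc_leI card_gt_0_iff empty_iff of_nat_1 of_nat_diff)
    have "(real (card (ed f)) - 1) - hit v f = (\<Sum>u\<in>ed f - {v}. - dev u) + err"
      unfolding c err_def by (simp add: sum_subtractf sum_negf)
    then have "2 * dev v * ((real (card (ed f)) - 1) - hit v f) =
        (\<Sum>u\<in>ed f - {v}. 2 * dev v * (- dev u)) + 2 * (dev v * err)"
      by (simp add: distrib_left sum_distrib_left)
    also have "\<dots> \<le> (\<Sum>u\<in>ed f - {v}. (dev v)\<^sup>2 + (dev u)\<^sup>2) + 2 * (b * (real r * real r * \<kappa>))"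
    proof (rule add_mono)
      show "(\<Sum>u\<in>ed f - {v}. 2 * dev v * (- dev u)) \<le> (\<Sum>u\<in>ed f - {v}. (dev v)\<^sup>2 + (dev u)\<^sup>2)"
      proof (rule sum_mono)
        fix u show "2 * dev v * (- dev u) \<le> (dev v)\<^sup>2 + (dev u)\<^sup>2"
          using zero_le_power2[of "dev v + dev u"] by (simp add: power2_eq_square algebra_simps)
      qed
      have "dev v * err \<le> b * err" using abs_dev_le[OF v] err by (intro mult_right_mono) auto
      also have "\<dots> \<le> b * (real r * real r * \<kappa>)" using err b_ge1 by (intro mult_left_mono) auto
      finally show "2 * (dev v * err) \<le> 2 * (b * (real r * real r * \<kappa>))" by simp
    qed
    finally show "2 * dev v * ((real (card (ed f)) - 1) - hit v f) \<le>
      (\<Sum>u\<in>ed f - {v}. (dev v)\<^sup>2 + (dev u)\<^sup>2) + 2 * b * (real r * real r * \<kappa>)" by (simp add: mult.assoc)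
  qed
  also have "\<dots> = (\<Sum>f | f \<in> J \<and> v \<in> ed f. w f * (\<Sum>u\<in>ed f - {v}. (dev v)\<^sup>2 + (dev u)\<^sup>2)) +
      deg v * (2 * b * (real r * real r * \<kappa>))"
    unfolding deg_def sum_distrib_right distrib_left sum.distrib by simp
  also have "deg v * (2 * b * (real r * real r * \<kappa>)) \<le> b * (2 * b * (real r * real r * \<kappa>))"
    using deg_le_b[OF v] b_ge1 \<kappa>_nonneg by (intro mult_right_mono) auto
  finally show ?thesis by (simp add: power2_eq_square mult_ac)
qed

lemma sum_pair_dev_le:
  "(\<Sum>v\<in>U. \<Sum>f | f \<in> J \<and> v \<in> ed f. w f * (\<Sum>u\<in>ed f - {v}. (dev v)\<^sup>2 + (dev u)\<^sup>2))
     \<le> 2 * real r * b * (\<Sum>v\<in>U. (dev v)\<^sup>2)"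
proof -
  have "(\<Sum>v\<in>U. \<Sum>f | f \<in> J \<and> v \<in> ed f. w f * (\<Sum>u\<in>ed f - {v}. (dev v)\<^sup>2 + (dev u)\<^sup>2)) =
      (\<Sum>f\<in>J. \<Sum>v | v \<in> U \<and> v \<in> ed f. w f * (\<Sum>u\<in>ed f - {v}. (dev v)\<^sup>2 + (dev u)\<^sup>2))"
    by (rule sum.swap_restrict[OF finite_U finite_J])
  also have "\<dots> \<le> (\<Sum>f\<in>J. w f * (\<Sum>v\<in>ed f. 2 * real r * (dev v)\<^sup>2))"
  proof (rule sum_mono)
    fix f assume f: "f \<in> J"
    have eq: "{v. v \<in> U \<and> v \<in> ed f} = ed f" using ed_sub[OF f] by auto
    have "(\<Sum>v\<in>ed f. \<Sum>u\<in>ed f - {v}. (dev v)\<^sup>2 + (dev u)\<^sup>2) \<le> (\<Sum>v\<in>ed f. \<Sum>u\<in>ed f. (dev v)\<^sup>2 + (dev u)\<^sup>2)"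
      using finite_ed[OF f] by (intro sum_mono sum_mono2) auto
    also have "\<dots> = real (card (ed f)) * (\<Sum>v\<in>ed f. (dev v)\<^sup>2) + real (card (ed f)) * (\<Sum>v\<in>ed f. (dev v)\<^sup>2)"
      by (simp add: sum.distrib sum_distrib_left)
    also have "\<dots> \<le> (\<Sum>v\<in>ed f. 2 * real r * (dev v)\<^sup>2)"
      using ed_card[OF f] by (simp add: sum_distrib_left[symmetric] mult_right_mono sum_nonneg)
    finally show "(\<Sum>v | v \<in> U \<and> v \<in> ed f. w f * (\<Sum>u\<in>ed f - {v}. (dev v)\<^sup>2 + (dev u)\<^sup>2)) \<le>
        w f * (\<Sum>v\<in>ed f. 2 * real r * (dev v)\<^sup>2)"
      unfolding eq sum_distrib_left[symmetric] by (rule mult_left_mono) (rule w_nonneg[OF f])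
  qed
  also have "\<dots> = (\<Sum>v\<in>U. deg v * (2 * real r * (dev v)\<^sup>2))"
    by (rule sum_deg_swap[symmetric])
  also have "\<dots> \<le> (\<Sum>v\<in>U. b * (2 * real r * (dev v)\<^sup>2))"
    by (intro sum_mono mult_right_mono deg_le_b) auto
  finally show ?thesis by (simp add: sum_distrib_left mult_ac)
qed

text \<open>The left side is the derivative in time of the sum of squared deviations plus its expected rate of
change when edges are chosen at rate \<open>w\<close>. Up to a term proportional to \<open>\<kappa>\<close> it is bounded by a multiple of the sum
itself, so deviations that start at zero stay small for a bounded time.\<close>

lemma potential_drift:
  "(\<Sum>v\<in>U. 2 * dev v * growth v) +
     (\<Sum>e\<in>J. w e * ((\<Sum>v\<in>U - ed e. (dev v - loss e v)\<^sup>2) - (\<Sum>v\<in>U. (dev v)\<^sup>2)))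
   \<le> 2 * real r * b * (\<Sum>v\<in>U. (dev v)\<^sup>2) + 3 * (real r)\<^sup>2 * b\<^sup>2 * \<kappa> * real (card U)"
proof -
  have "(\<Sum>e\<in>J. w e * ((\<Sum>v\<in>U - ed e. (dev v - loss e v)\<^sup>2) - (\<Sum>v\<in>U. (dev v)\<^sup>2)))
      \<le> (\<Sum>e\<in>J. \<Sum>v | v \<in> U \<and> v \<notin> ed e. w e * ((loss e v)\<^sup>2 - 2 * dev v * loss e v))"
  proof (rule sum_mono)
    fix e assume e: "e \<in> J"
    have "(\<Sum>v\<in>U - ed e. (dev v)\<^sup>2) \<le> (\<Sum>v\<in>U. (dev v)\<^sup>2)"
      using finite_U by (intro sum_mono2) auto
    then have "(\<Sum>v\<in>U - ed e. (dev v - loss e v)\<^sup>2) - (\<Sum>v\<in>U. (dev v)\<^sup>2) \<le>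
        (\<Sum>v\<in>U - ed e. (dev v - loss e v)\<^sup>2 - (dev v)\<^sup>2)"
      by (simp add: sum_subtractf)
    also have "\<dots> = (\<Sum>v | v \<in> U \<and> v \<notin> ed e. (loss e v)\<^sup>2 - 2 * dev v * loss e v)"
      by (rule sum.cong) (auto simp: power2_eq_square algebra_simps)
    finally show "w e * ((\<Sum>v\<in>U - ed e. (dev v - loss e v)\<^sup>2) - (\<Sum>v\<in>U. (dev v)\<^sup>2)) \<le>
        (\<Sum>v | v \<in> U \<and> v \<notin> ed e. w e * ((loss e v)\<^sup>2 - 2 * dev v * loss e v))"
      unfolding sum_distrib_left[symmetric] by (rule mult_left_mono) (rule w_nonneg[OF e])
  qed
  also have "\<dots> = (\<Sum>v\<in>U. \<Sum>e | e \<in> J \<and> v \<notin> ed e. w e * ((loss e v)\<^sup>2 - 2 * dev v * loss e v))"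
    by (rule sum.swap_restrict[OF finite_U finite_J, symmetric])
  also have "\<dots> = (\<Sum>v\<in>U. (\<Sum>e | e \<in> J \<and> v \<notin> ed e. w e * (loss e v)\<^sup>2) - 2 * dev v * expected_loss v)"
    unfolding expected_loss_def sum_distrib_left sum_subtractf[symmetric]
    by (intro sum.cong refl) (simp add: algebra_simps)
  finally have "(\<Sum>v\<in>U. 2 * dev v * growth v) +
     (\<Sum>e\<in>J. w e * ((\<Sum>v\<in>U - ed e. (dev v - loss e v)\<^sup>2) - (\<Sum>v\<in>U. (dev v)\<^sup>2)))
     \<le> (\<Sum>v\<in>U. 2 * dev v * growth v) + (\<Sum>v\<in>U. (\<Sum>e | e \<in> J \<and> v \<notin> ed e. w e * (loss e v)\<^sup>2) - 2 * dev v * expected_loss v)"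
    by simp
  also have "\<dots> = (\<Sum>v\<in>U. 2 * dev v * (growth v - expected_loss v) + (\<Sum>e | e \<in> J \<and> v \<notin> ed e. w e * (loss e v)\<^sup>2))"
    unfolding sum.distrib[symmetric] by (intro sum.cong refl) (simp add: algebra_simps)
  also have "\<dots> \<le> (\<Sum>v\<in>U. ((\<Sum>f | f \<in> J \<and> v \<in> ed f. w f * (\<Sum>u\<in>ed f - {v}. (dev v)\<^sup>2 + (dev u)\<^sup>2))
      + 2 * (real r)\<^sup>2 * b\<^sup>2 * \<kappa>) + (real r)\<^sup>2 * b\<^sup>2 * \<kappa>)"
    by (intro sum_mono add_mono growth_minus_expected_loss expected_loss_sq_le)
  also have "\<dots> = (\<Sum>v\<in>U. \<Sum>f | f \<in> J \<and> v \<in> ed f. w f * (\<Sum>u\<in>ed f - {v}. (dev v)\<^sup>2 + (dev u)\<^sup>2)) +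
      3 * (real r)\<^sup>2 * b\<^sup>2 * \<kappa> * real (card U)"
    unfolding sum.distrib by (simp add: algebra_simps)
  finally show ?thesis using sum_pair_dev_le by linarith
qed

text \<open>Vertices are deleted at the rate \<open>\<Sum>\<^sub>e w e |e| = \<Sum>\<^sub>v deg v\<close>, which is about \<open>|U|\<close>; half of that
is a safe bound, because \<open>deg v \<ge> 1 / 2 - (deg v - 1)\<^sup>2 / 2\<close>.\<close>

lemma size_drift:
  "(\<Sum>e\<in>J. w e * (real (card (U - ed e)) - real (card U))) \<le> - real (card U) / 2 + (\<Sum>v\<in>U. (dev v)\<^sup>2) / 2"
proof -
  have "(\<Sum>e\<in>J. w e * (real (card (U - ed e)) - real (card U))) = (\<Sum>e\<in>J. w e * (\<Sum>v\<in>ed e. - 1))"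
  proof (intro sum.cong refl)
    fix e assume e: "e \<in> J"
    have "card (U - ed e) = card U - card (ed e)" "card (ed e) \<le> card U"
      using ed_sub[OF e] finite_U finite_ed[OF e] by (auto intro: card_Diff_subset card_mono)
    then show "w e * (real (card (U - ed e)) - real (card U)) = w e * (\<Sum>v\<in>ed e. - 1)"
      by (simp add: of_nat_diff)
  qed
  also have "\<dots> = (\<Sum>v\<in>U. deg v * (- 1))" by (rule sum_deg_swap[symmetric])
  also have "\<dots> \<le> (\<Sum>v\<in>U. - 1 / 2 + (dev v)\<^sup>2 / 2)"
  proof (rule sum_mono)
    fix v show "deg v * (- 1) \<le> - 1 / 2 + (dev v)\<^sup>2 / 2"
      using zero_le_power2[of "deg v"] by (simp add: power2_eq_square algebra_simps)
  qed
  also have "\<dots> = - real (card U) / 2 + (\<Sum>v\<in>U. (dev v)\<^sup>2) / 2"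
    by (simp add: sum.distrib sum_subtractf sum_divide_distrib)
  finally show ?thesis .
qed

end


section \<open>Near-perfect matchings from fractional ones\<close>

locale fractional_matching =
  fixes V :: "'v set" and I :: "'i set" and ed :: "'i \<Rightarrow> 'v set" and w :: "'i \<Rightarrow> real"
    and r :: nat and \<kappa> :: real
  assumes finite_V: "finite V" and finite_I: "finite I"
    and ed_sub: "i \<in> I \<Longrightarrow> ed i \<subseteq> V"
    and ed_nonempty: "i \<in> I \<Longrightarrow> ed i \<noteq> {}"
    and ed_card: "i \<in> I \<Longrightarrow> card (ed i) \<le> r"
    and w_nonneg: "i \<in> I \<Longrightarrow> 0 \<le> w i"
    and deg_eq_1: "v \<in> V \<Longrightarrow> (\<Sum>i | i \<in> I \<and> v \<in> ed i. w i) = 1"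
    and \<kappa>_nonneg: "0 \<le> \<kappa>"
    and codeg_le: "u \<in> V \<Longrightarrow> v \<in> V \<Longrightarrow> u \<noteq> v \<Longrightarrow>
        (\<Sum>i | i \<in> I \<and> u \<in> ed i \<and> v \<in> ed i. w i) \<le> \<kappa>"
begin

text \<open>The state of the process is the set \<open>U\<close> of unmatched vertices together with the time \<open>\<theta>\<close>. The
weight \<open>wt\<close> is normalised so that all degrees would stay \<open>1\<close> if every vertex survived up to time \<open>\<theta>\<close>
independently with probability \<open>exp (- \<theta>)\<close>: an edge at a surviving vertex survives with
probability \<open>exp (- \<theta> (|e| - 1))\<close>.\<close>

definition alive :: "'v set \<Rightarrow> 'i set" where
  "alive U = {i \<in> I. ed i \<subseteq> U}"

definition wt :: "real \<Rightarrow> 'i \<Rightarrow> real" where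
  "wt \<theta> i = w i * exp (\<theta> * (real (card (ed i)) - 1))"

definition alive_deg :: "'v set \<Rightarrow> real \<Rightarrow> 'v \<Rightarrow> real" where
  "alive_deg U \<theta> v = (\<Sum>i | i \<in> alive U \<and> v \<in> ed i. wt \<theta> i)"

definition dispersion :: "'v set \<Rightarrow> real \<Rightarrow> real" where
  "dispersion U \<theta> = (\<Sum>v\<in>U. (alive_deg U \<theta> v - 1)\<^sup>2)"

lemma finite_alive: "finite (alive U)"
  using finite_I by (simp add: alive_def)

lemma wt_nonneg: "i \<in> I \<Longrightarrow> 0 \<le> wt \<theta> i"
  by (simp add: wt_def w_nonneg)

lemma wt_le:
  assumes i: "i \<in> I" and \<theta>: "0 \<le> \<theta>" "\<theta> \<le> \<tau>"
  shows "wt \<theta> i \<le> w i * exp (\<tau> * real r)"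
proof -
  have "\<theta> * (real (card (ed i)) - 1) \<le> \<theta> * real r"
    using ed_card[OF i] \<theta>(1) by (intro mult_left_mono) auto
  also have "\<dots> \<le> \<tau> * real r" using \<theta> by (intro mult_right_mono) auto
  finally show ?thesis unfolding wt_def using w_nonneg[OF i] by (intro mult_left_mono) auto
qed

lemma sum_wt_le:
  assumes \<theta>: "0 \<le> \<theta>" "\<theta> \<le> \<tau>"
  shows "(\<Sum>i | i \<in> alive U \<and> P i. wt \<theta> i) \<le> (\<Sum>i | i \<in> I \<and> P i. w i) * exp (\<tau> * real r)"
proof -
  have "(\<Sum>i | i \<in> alive U \<and> P i. wt \<theta> i) \<le> (\<Sum>i | i \<in> I \<and> P i. wt \<theta> i)"
    using finite_I wt_nonneg by (intro sum_mono2) (auto simp: alive_def)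
  also have "\<dots> \<le> (\<Sum>i | i \<in> I \<and> P i. w i * exp (\<tau> * real r))"
    using \<theta> by (intro sum_mono wt_le) auto
  finally show ?thesis by (simp add: sum_distrib_right)
qed

lemma alive_hypergraph:
  assumes U: "U \<subseteq> V" and \<theta>: "0 \<le> \<theta>" "\<theta> \<le> \<tau>"
  shows "weighted_hypergraph U (alive U) ed (wt \<theta>) r (exp (\<tau> * real r)) (\<kappa> * exp (\<tau> * real r))"
proof
  show "finite U" using U finite_V finite_subset by blast
  show "finite (alive U)" by (rule finite_alive)
  show "ed i \<subseteq> U" "card (ed i) \<le> r" "0 \<le> wt \<theta> i" if "i \<in> alive U" for i
    using that ed_card wt_nonneg by (auto simp: alive_def)
  show "1 \<le> exp (\<tau> * real r)" using \<theta> by simp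
  show "0 \<le> \<kappa> * exp (\<tau> * real r)" using \<kappa>_nonneg by simp
  show "(\<Sum>i | i \<in> alive U \<and> v \<in> ed i. wt \<theta> i) \<le> exp (\<tau> * real r)" if "v \<in> U" for v
    using sum_wt_le[OF \<theta>, of U "\<lambda>i. v \<in> ed i"] deg_eq_1[of v] that U by auto
  show "(\<Sum>i | i \<in> alive U \<and> u \<in> ed i \<and> v \<in> ed i. wt \<theta> i) \<le> \<kappa> * exp (\<tau> * real r)"
    if "u \<in> U" "v \<in> U" "u \<noteq> v" for u v
  proof -
    have "(\<Sum>i | i \<in> I \<and> u \<in> ed i \<and> v \<in> ed i. w i) * exp (\<tau> * real r) \<le> \<kappa> * exp (\<tau> * real r)"
      using codeg_le[of u v] that U by (intro mult_right_mono) auto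
    with sum_wt_le[OF \<theta>, of U "\<lambda>i. u \<in> ed i \<and> v \<in> ed i"] show ?thesis by linarith
  qed
qed

lemma has_derivative_dispersion:
  "((\<lambda>\<theta>. dispersion U \<theta>) has_real_derivative
     (\<Sum>v\<in>U. 2 * (alive_deg U \<theta> v - 1) *
        (\<Sum>i | i \<in> alive U \<and> v \<in> ed i. wt \<theta> i * (real (card (ed i)) - 1)))) (at \<theta>)"
proof -
  have deriv: "((\<lambda>\<theta>. alive_deg U \<theta> v) has_real_derivative
      (\<Sum>i | i \<in> alive U \<and> v \<in> ed i. wt \<theta> i * (real (card (ed i)) - 1))) (at \<theta>)" for v
    unfolding alive_deg_def wt_def
    by (rule DERIV_sum) (auto intro!: derivative_eq_intros)
  show ?thesis
    unfolding dispersion_def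
  proof (rule DERIV_sum)
    fix v
    show "((\<lambda>\<theta>. (alive_deg U \<theta> v - 1)\<^sup>2) has_real_derivative
        2 * (alive_deg U \<theta> v - 1) *
          (\<Sum>i | i \<in> alive U \<and> v \<in> ed i. wt \<theta> i * (real (card (ed i)) - 1))) (at \<theta>)"
      by (rule DERIV_cong[OF DERIV_power[OF DERIV_diff[OF deriv DERIV_const]]]) (simp add: algebra_simps)
  qed
qed

lemma continuous_dispersion: "continuous_on A (dispersion U)"
  by (intro continuous_at_imp_continuous_on ballI DERIV_isCont[OF has_derivative_dispersion])

text \<open>The factor of the dispersion decreases in time, at a rate \<open>K\<close> that outweighs the possible
exponential growth of the dispersion; it is \<open>1\<close> at the final time \<open>\<tau>\<close>.\<close>

definition potential :: "real \<Rightarrow> real \<Rightarrow> 'v set \<Rightarrow> real \<Rightarrow> real" where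
  "potential K \<tau> U \<theta> = real (card U) + exp (K * (\<tau> - \<theta>)) * dispersion U \<theta>"

lemma alive_deg_remove_edge:
  assumes e: "e \<in> alive U" and v: "v \<in> U - ed e"
  shows "alive_deg (U - ed e) \<theta> v = alive_deg U \<theta> v -
    (\<Sum>f | f \<in> alive U \<and> (v \<in> ed f \<and> ed f \<inter> ed e \<noteq> {}). wt \<theta> f)"
proof -
  have "{i. i \<in> alive U \<and> v \<in> ed i} =
      {i. i \<in> alive (U - ed e) \<and> v \<in> ed i} \<union> {f. f \<in> alive U \<and> (v \<in> ed f \<and> ed f \<inter> ed e \<noteq> {})}"
    by (auto simp: alive_def)
  moreover have "{i. i \<in> alive (U - ed e) \<and> v \<in> ed i} \<inter>
      {f. f \<in> alive U \<and> (v \<in> ed f \<and> ed f \<inter> ed e \<noteq> {})} = {}"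
    by (auto simp: alive_def)
  ultimately show ?thesis
    unfolding alive_deg_def by (simp add: sum.union_disjoint finite_alive)
qed

text \<open>The derivative of the potential in time plus its expected rate of change under choosing edges is at
most minus half the potential, up to the error \<open>D\<close>. If no choice of an edge decreases the potential, the
second summand is nonnegative, so the derivative alone obeys the bound; the factor
\<open>exp (\<theta> / 2)\<close> and the shift by \<open>2 D\<close> turn it into monotonicity.\<close>

lemma potential_decreasing:
  assumes U: "U \<subseteq> V" and \<theta>: "0 \<le> \<theta>" "\<theta> \<le> \<tau>"
    and K: "K = 2 * real r * exp (\<tau> * real r) + 1"
    and D: "D = exp (K * \<tau>) * (3 * (real r)\<^sup>2 * (exp (\<tau> * real r))\<^sup>2 * (\<kappa> * exp (\<tau> * real r)) * real (card V))"
    and nojump: "\<And>e. e \<in> alive U \<Longrightarrow> potential K \<tau> U \<theta> \<le> potential K \<tau> (U - ed e) \<theta>"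
  shows "\<exists>y\<le>0. ((\<lambda>\<theta>. exp (\<theta> / 2) * (potential K \<tau> U \<theta> - 2 * D)) has_real_derivative y) (at \<theta>)"
proof -
  define b where "b = exp (\<tau> * real r)"
  interpret H: weighted_hypergraph U "alive U" ed "wt \<theta>" r b "\<kappa> * b"
    unfolding b_def by (rule alive_hypergraph[OF U \<theta>])
  define E where "E = exp (K * (\<tau> - \<theta>))"
  define \<Phi> where "\<Phi> = dispersion U \<theta>"
  define \<Phi>' where "\<Phi>' = (\<Sum>v\<in>U. 2 * H.dev v * H.growth v)"
  have deg: "H.deg v = alive_deg U \<theta> v" for v by (simp add: H.deg_def alive_deg_def)
  have \<Phi>: "\<Phi> = (\<Sum>v\<in>U. (H.dev v)\<^sup>2)" by (simp add: \<Phi>_def dispersion_def deg)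
  have \<Phi>0: "0 \<le> \<Phi>" unfolding \<Phi> by (rule sum_nonneg) auto
  have K0: "K \<ge> 0" unfolding K by simp
  have E1: "1 \<le> E" unfolding E_def using K0 \<theta> by simp
  have dPhi: "(dispersion U has_real_derivative \<Phi>') (at \<theta>)"
    using has_derivative_dispersion[of U \<theta>] by (simp add: \<Phi>'_def H.growth_def deg)
  have jump: "dispersion (U - ed e) \<theta> = (\<Sum>v\<in>U - ed e. (H.dev v - H.loss e v)\<^sup>2)" if "e \<in> alive U" for e
    unfolding dispersion_def H.loss_def
    by (intro sum.cong refl) (simp add: alive_deg_remove_edge[OF that] deg algebra_simps)
  have pot: "potential K \<tau> X \<theta> = real (card X) + E * dispersion X \<theta>" for X
    by (simp add: potential_def E_def)
  have "0 \<le> (\<Sum>e\<in>alive U. wt \<theta> e * (potential K \<tau> (U - ed e) \<theta> - potential K \<tau> U \<theta>))"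
    using nojump by (intro sum_nonneg mult_nonneg_nonneg H.w_nonneg) auto
  also have "\<dots> = E * (\<Sum>e\<in>alive U. wt \<theta> e * ((\<Sum>v\<in>U - ed e. (H.dev v - H.loss e v)\<^sup>2) - (\<Sum>v\<in>U. (H.dev v)\<^sup>2)))
      + (\<Sum>e\<in>alive U. wt \<theta> e * (real (card (U - ed e)) - real (card U)))"
    unfolding sum_distrib_left sum.distrib[symmetric] 
    by (intro sum.cong refl) (simp add: pot jump \<Phi>_def[symmetric] \<Phi>[symmetric] algebra_simps)
  finally have gen: "0 \<le> E * (\<Sum>e\<in>alive U. wt \<theta> e * ((\<Sum>v\<in>U - ed e. (H.dev v - H.loss e v)\<^sup>2) - (\<Sum>v\<in>U. (H.dev v)\<^sup>2)))
      + (- real (card U) / 2 + \<Phi> / 2)"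
    using H.size_drift unfolding \<Phi> by linarith
  have "E * (\<Phi>' + (\<Sum>e\<in>alive U. wt \<theta> e * ((\<Sum>v\<in>U - ed e. (H.dev v - H.loss e v)\<^sup>2) - (\<Sum>v\<in>U. (H.dev v)\<^sup>2))))
      \<le> E * (2 * real r * b * \<Phi> + 3 * (real r)\<^sup>2 * b\<^sup>2 * (\<kappa> * b) * real (card U))"
    using H.potential_drift E1 unfolding \<Phi>'_def \<Phi> by (intro mult_left_mono) auto
  with gen have drift: "E * \<Phi>' \<le> E * (2 * real r * b * \<Phi>) + E * (3 * (real r)\<^sup>2 * b\<^sup>2 * (\<kappa> * b) * real (card U))
      - real (card U) / 2 + \<Phi> / 2"
    by (simp add: distrib_left)
  have "E * (3 * (real r)\<^sup>2 * b\<^sup>2 * (\<kappa> * b) * real (card U)) \<le> D"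
    unfolding D b_def[symmetric]
  proof (rule mult_mono)
    show "E \<le> exp (K * \<tau>)" unfolding E_def using K0 \<theta> by (simp add: mult_left_mono)
    have "card U \<le> card V" using U finite_V by (rule card_mono[rotated])
    then show "3 * (real r)\<^sup>2 * b\<^sup>2 * (\<kappa> * b) * real (card U) \<le> 3 * (real r)\<^sup>2 * b\<^sup>2 * (\<kappa> * b) * real (card V)"
      using \<kappa>_nonneg by (intro mult_left_mono) (auto simp: b_def)
  qed (use \<kappa>_nonneg in \<open>auto simp: b_def\<close>)
  moreover have "\<Phi> / 2 \<le> E * \<Phi> / 2" using mult_right_mono[OF E1 \<Phi>0] by simp
  ultimately have neg: "1 / 2 * (real (card U) + E * \<Phi> - 2 * D) + (E * \<Phi>' - K * E * \<Phi>) \<le> 0"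
    using drift unfolding K b_def[symmetric] by (simp add: algebra_simps)
  have dpot: "((\<lambda>\<theta>. exp (\<theta> / 2) * (potential K \<tau> U \<theta> - 2 * D)) has_real_derivative
      exp (\<theta> / 2) * (1 / 2 * (real (card U) + E * \<Phi> - 2 * D) + (E * \<Phi>' - K * E * \<Phi>))) (at \<theta>)"
    unfolding potential_def
    by (auto intro!: derivative_eq_intros dPhi simp: E_def \<Phi>_def algebra_simps)
  show ?thesis
    by (intro exI[of _ "exp (\<theta> / 2) * (1 / 2 * (real (card U) + E * \<Phi> - 2 * D) + (E * \<Phi>' - K * E * \<Phi>))"] conjI dpot)
      (use neg in \<open>simp add: mult_nonneg_nonpos\<close>)
qed

lemma continuous_potential: "continuous_on A (potential K \<tau> U)"
  unfolding potential_def by (intro continuous_intros continuous_dispersion)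

text \<open>Let time run until an edge becomes available whose removal does not increase the potential; take it and
continue with fewer vertices. The times at which some edge is available form a compact set, so there is a first one.\<close>

lemma greedy_matching:
  assumes K: "K = 2 * real r * exp (\<tau> * real r) + 1"
    and D: "D = exp (K * \<tau>) * (3 * (real r)\<^sup>2 * (exp (\<tau> * real r))\<^sup>2 * (\<kappa> * exp (\<tau> * real r)) * real (card V))"
    and U: "U \<subseteq> V" and \<theta>: "0 \<le> \<theta>" "\<theta> \<le> \<tau>"
  shows "\<exists>S\<subseteq>alive U. disjoint_family_on ed S \<and>
     exp (\<tau> / 2) * (potential K \<tau> (U - \<Union>(ed ` S)) \<tau> - 2 * D) \<le> exp (\<theta> / 2) * (potential K \<tau> U \<theta> - 2 * D)"
  using U \<theta>
proof (induction "card U" arbitrary: U \<theta> rule: less_induct)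
  case less
  note U = less.prems(1) and \<theta> = less.prems(2,3)
  define Z where "Z U \<theta> = exp (\<theta> / 2) * (potential K \<tau> U \<theta> - 2 * D)" for U \<theta>
  define T where "T = {\<theta>..\<tau>} \<inter> (\<Union>e\<in>alive U. {x. potential K \<tau> (U - ed e) x \<le> potential K \<tau> U x})"
  have flow: "Z U y \<le> Z U \<theta>" if y: "\<theta> \<le> y" "y \<le> \<tau>" and no: "\<And>x. \<theta> < x \<Longrightarrow> x < y \<Longrightarrow> x \<notin> T" for y
  proof (rule DERIV_nonpos_imp_decreasing_open[OF y(1)])
    fix x assume x: "\<theta> < x" "x < y"
    show "\<exists>d. (Z U has_real_derivative d) (at x) \<and> d \<le> 0"
      using potential_decreasing[OF U _ _ K D, of x] no[OF x] x y \<theta>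
      unfolding Z_def by (force simp: T_def)
  next
    show "continuous_on {\<theta>..y} (Z U)"
      unfolding Z_def by (intro continuous_intros continuous_potential) auto
  qed
  show ?case
  proof (cases "T = {}")
    case True
    then have "Z U \<tau> \<le> Z U \<theta>" using \<theta> by (intro flow) auto
    then show ?thesis by (intro exI[of _ "{}"]) (auto simp: Z_def disjoint_family_on_def)
  next
    case False
    define x where "x = Inf T"
    have "closed T"
      unfolding T_def
      by (intro closed_Int closed_atLeastAtMost closed_UN finite_alive ballI closed_Collect_le continuous_potential)
    moreover have bdd: "bdd_below T" by (rule bdd_belowI[of _ \<theta>]) (auto simp: T_def)
    ultimately have xT: "x \<in> T" unfolding x_def by (intro closed_contains_Inf False)
    then obtain e where e: "e \<in> alive U" "potential K \<tau> (U - ed e) x \<le> potential K \<tau> U x"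
      and x: "\<theta> \<le> x" "x \<le> \<tau>" by (auto simp: T_def)
    have "z \<notin> T" if "z < x" for z
      using cInf_lower[OF _ bdd, of z] that unfolding x_def by linarith
    then have Zx: "Z U x \<le> Z U \<theta>" using x by (intro flow) auto
    have eU: "ed e \<subseteq> U" "ed e \<noteq> {}" using e ed_nonempty by (auto simp: alive_def)
    have "finite U" using U finite_V finite_subset by blast
    then have "card (U - ed e) < card U" using eU by (intro psubset_card_mono) auto
    from less.hyps[OF this, of x] U x \<theta> obtain S where
      S: "S \<subseteq> alive (U - ed e)" "disjoint_family_on ed S" "Z (U - ed e - \<Union>(ed ` S)) \<tau> \<le> Z (U - ed e) x"
      unfolding Z_def by force
    have "disjoint_family_on ed (insert e S)"
      using S(1,2) unfolding disjoint_family_on_def alive_def by blast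
    moreover have "insert e S \<subseteq> alive U" using S(1) e(1) by (auto simp: alive_def)
    moreover have "Z (U - \<Union>(ed ` insert e S)) \<tau> \<le> Z U \<theta>"
    proof -
      have "U - \<Union>(ed ` insert e S) = U - ed e - \<Union>(ed ` S)" by auto
      moreover have "Z (U - ed e) x \<le> Z U x" unfolding Z_def using e(2) by simp
      ultimately show ?thesis using S(3) Zx by simp
    qed
    ultimately show ?thesis unfolding Z_def by blast
  qed
qed

lemma matching_bound:
  assumes \<tau>: "0 \<le> \<tau>" and K: "K = 2 * real r * exp (\<tau> * real r) + 1"
  shows "\<exists>S\<subseteq>I. disjoint_family_on ed S \<and> real (card (V - \<Union>(ed ` S))) \<le>
    (exp (- \<tau> / 2) + 2 * exp (K * \<tau>) * (3 * (real r)\<^sup>2 * (exp (\<tau> * real r))\<^sup>2 * (\<kappa> * exp (\<tau> * real r)))) * real (card V)"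
proof -
  define D where "D = exp (K * \<tau>) * (3 * (real r)\<^sup>2 * (exp (\<tau> * real r))\<^sup>2 * (\<kappa> * exp (\<tau> * real r)) * real (card V))"
  obtain S where S: "S \<subseteq> alive V" "disjoint_family_on ed S"
    and le: "exp (\<tau> / 2) * (potential K \<tau> (V - \<Union>(ed ` S)) \<tau> - 2 * D) \<le> exp (0 / 2) * (potential K \<tau> V 0 - 2 * D)"
    using greedy_matching[OF K D_def order_refl order_refl \<tau>] by auto
  have "alive_deg V 0 v = 1" if "v \<in> V" for v
  proof -
    have "{i. i \<in> alive V \<and> v \<in> ed i} = {i. i \<in> I \<and> v \<in> ed i}" using ed_sub by (auto simp: alive_def)
    then show ?thesis using deg_eq_1[OF that] by (simp add: alive_deg_def wt_def)
  qed
  then have "dispersion V 0 = 0" by (simp add: dispersion_def)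
  then have pot0: "potential K \<tau> V 0 = real (card V)" by (simp add: potential_def)
  have D0: "0 \<le> D" unfolding D_def using \<kappa>_nonneg by simp
  define P where "P = potential K \<tau> (V - \<Union>(ed ` S)) \<tau>"
  have "exp (\<tau> / 2) * (P - 2 * D) \<le> real (card V)" using le D0 unfolding pot0 P_def by simp
  then have "P - 2 * D \<le> exp (- \<tau> / 2) * real (card V)"
    by (simp add: exp_minus field_simps)
  moreover have "real (card (V - \<Union>(ed ` S))) \<le> P"
    unfolding P_def potential_def dispersion_def by (simp add: sum_nonneg)
  ultimately have "real (card (V - \<Union>(ed ` S))) \<le> exp (- \<tau> / 2) * real (card V) + 2 * D" by linarith
  then show ?thesis using S unfolding D_def by (intro exI[of _ S]) (auto simp: alive_def algebra_simps)
qed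

end

text \<open>The proportion of unmatched vertices is at most \<open>exp (- \<tau> / 2)\<close> plus a multiple of \<open>\<kappa>\<close> that depends on
\<open>\<tau>\<close> and \<open>r\<close>, so \<open>\<tau>\<close> is chosen first and \<open>\<kappa>\<close> afterwards.\<close>

theorem near_perfect_matching:
  fixes \<delta> :: real and r :: nat
  assumes \<delta>: "0 < \<delta>" "\<delta> < 1"
  obtains \<kappa> :: real where "0 < \<kappa>"
    "\<And>(V :: 'v set) (I :: 'i set) ed w. fractional_matching V I ed w r \<kappa> \<Longrightarrow>
       \<exists>S\<subseteq>I. disjoint_family_on ed S \<and> real (card (V - \<Union>(ed ` S))) \<le> \<delta> * real (card V)"
proof -
  \<comment> \<open>at this time \<open>exp (- \<tau> / 2) = \<delta> / 2\<close>\<close>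
  define \<tau> where "\<tau> = 2 * ln (2 / \<delta>)"
  define K where "K = 2 * real r * exp (\<tau> * real r) + 1"
  define C where "C = 2 * exp (K * \<tau>) * (3 * (real r)\<^sup>2 * (exp (\<tau> * real r))\<^sup>2 * exp (\<tau> * real r))"
  define \<kappa> where "\<kappa> = \<delta> / (2 * (C + 1))"
  have C0: "0 \<le> C" by (simp add: C_def)
  have \<tau>: "0 \<le> \<tau>" using \<delta> by (simp add: \<tau>_def)
  have "exp (- \<tau> / 2) = \<delta> / 2" using \<delta> by (simp add: \<tau>_def exp_minus)
  moreover have "C * \<kappa> \<le> \<delta> / 2" using C0 \<delta> by (simp add: \<kappa>_def field_simps)
  ultimately have le: "exp (- \<tau> / 2) + C * \<kappa> \<le> \<delta>" by simp
  show ?thesis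
  proof (rule that)
    show "0 < \<kappa>" using C0 \<delta> by (simp add: \<kappa>_def)
    fix V :: "'v set" and I :: "'i set" and ed w
    assume "fractional_matching V I ed w r \<kappa>"
    then interpret fractional_matching V I ed w r \<kappa> .
    obtain S where S: "S \<subseteq> I" "disjoint_family_on ed S"
      "real (card (V - \<Union>(ed ` S))) \<le> (exp (- \<tau> / 2) + C * \<kappa>) * real (card V)"
      using matching_bound[OF \<tau> K_def] unfolding C_def by (auto simp: mult_ac)
    have "real (card (V - \<Union>(ed ` S))) \<le> \<delta> * real (card V)"
      using S(3) mult_right_mono[OF le, of "real (card V)"] by simp
    with S show "\<exists>S\<subseteq>I. disjoint_family_on ed S \<and> real (card (V - \<Union>(ed ` S))) \<le> \<delta> * real (card V)" by blast
  qed
qed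


section \<open>Disjoint arithmetic progressions\<close>

definition ap :: "nat \<Rightarrow> nat \<Rightarrow> nat \<Rightarrow> nat set" where
  "ap n d t = (\<lambda>i. t + i * d) ` {..<n}"

definition packable :: "nat \<Rightarrow> nat set \<Rightarrow> nat set \<Rightarrow> bool" where
  "packable n D F \<longleftrightarrow>
     (\<exists>t. (\<forall>d\<in>D. ap n d (t d) \<subseteq> F) \<and> disjoint_family_on (\<lambda>d. ap n d (t d)) D)"

lemma finite_ap [simp]: "finite (ap n d t)"
  by (simp add: ap_def)

lemma card_ap_le: "card (ap n d t) \<le> n"
  unfolding ap_def using card_image_le[of "{..<n}"] by auto

lemma packable_Un:
  assumes "packable n D F" "packable n D' F'" "D \<inter> D' = {}" "F \<inter> F' = {}"
  shows "packable n (D \<union> D') (F \<union> F')"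
proof -
  obtain t where t: "\<forall>d\<in>D. ap n d (t d) \<subseteq> F" "disjoint_family_on (\<lambda>d. ap n d (t d)) D"
    using assms(1) unfolding packable_def by blast
  obtain t' where t': "\<forall>d\<in>D'. ap n d (t' d) \<subseteq> F'" "disjoint_family_on (\<lambda>d. ap n d (t' d)) D'"
    using assms(2) unfolding packable_def by blast
  define u where "u d = (if d \<in> D then t d else t' d)" for d
  have uD: "u d = t d" if "d \<in> D" for d using that by (simp add: u_def)
  have uD': "u d = t' d" if "d \<in> D'" for d using that assms(3) by (auto simp: u_def)
  have sub: "ap n d (u d) \<subseteq> F" if "d \<in> D" for d using t(1) that by (simp add: uD)
  have sub': "ap n d (u d) \<subseteq> F'" if "d \<in> D'" for d using t'(1) that by (simp add: uD')
  have "disjoint_family_on (\<lambda>d. ap n d (u d)) (D \<union> D')"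
    unfolding disjoint_family_on_def
  proof (intro ballI impI)
    fix a b assume ab: "a \<in> D \<union> D'" "b \<in> D \<union> D'" "a \<noteq> b"
    consider "a \<in> D" "b \<in> D" | "a \<in> D'" "b \<in> D'" | "a \<in> D" "b \<in> D'" | "a \<in> D'" "b \<in> D" using ab by blast
    then show "ap n a (u a) \<inter> ap n b (u b) = {}"
    proof cases
      case 1 then show ?thesis using t(2) ab(3) by (simp add: uD disjoint_family_on_def)
    next
      case 2 then show ?thesis using t'(2) ab(3) by (simp add: uD' disjoint_family_on_def)
    next
      case 3 then show ?thesis using sub[of a] sub'[of b] assms(4) by blast
    next
      case 4 then show ?thesis using sub[of b] sub'[of a] assms(4) by blast
    qed
  qed
  moreover have "\<forall>d\<in>D \<union> D'. ap n d (u d) \<subseteq> F \<union> F'" using sub sub' by blast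
  ultimately show ?thesis unfolding packable_def by blast
qed

text \<open>A progression placed earlier has at most \<open>n\<close> points, and each of them blocks at most \<open>n\<close> starts
of the new progression.\<close>

lemma packable_greedy:
  assumes "finite D"
    and "\<And>d. d \<in> D \<Longrightarrow> \<exists>T. finite T \<and> (\<forall>t\<in>T. ap n d t \<subseteq> F) \<and> n * n * card D < card T"
  shows "packable n D F"
  using assms
proof (induction D rule: finite_induct)
  case empty
  show ?case by (simp add: packable_def disjoint_family_on_def)
next
  case (insert d D)
  have "packable n D F"
  proof (rule insert.IH)
    fix e assume "e \<in> D"
    then obtain T where "finite T" "\<forall>t\<in>T. ap n e t \<subseteq> F" "n * n * card (insert d D) < card T"
      using insert.prems[of e] by auto
    moreover have "n * n * card D \<le> n * n * card (insert d D)"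
      using insert.hyps by (intro mult_left_mono) auto
    ultimately show "\<exists>T. finite T \<and> (\<forall>t\<in>T. ap n e t \<subseteq> F) \<and> n * n * card D < card T"
      by (meson le_less_trans)
  qed
  then obtain t where t: "\<forall>e\<in>D. ap n e (t e) \<subseteq> F" "disjoint_family_on (\<lambda>e. ap n e (t e)) D"
    unfolding packable_def by blast
  obtain T where T: "finite T" "\<forall>t\<in>T. ap n d t \<subseteq> F" "n * n * card (insert d D) < card T"
    using insert.prems[of d] by auto
  define X where "X = (\<Union>e\<in>D. ap n e (t e))"
  define blocked where "blocked = (\<lambda>(x, i). x - i * d) ` (X \<times> {..<n})"
  have "card X \<le> (\<Sum>e\<in>D. card (ap n e (t e)))"
    unfolding X_def by (rule card_UN_le[OF insert.hyps(1)])
  also have "\<dots> \<le> (\<Sum>e\<in>D. n)" by (intro sum_mono card_ap_le)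
  finally have X: "card X \<le> card D * n" by simp
  have finX: "finite X" unfolding X_def using insert.hyps(1) by auto
  have "card blocked \<le> card (X \<times> {..<n})" unfolding blocked_def using finX by (intro card_image_le) auto
  also have "\<dots> \<le> card D * n * n" using X by (simp add: card_cartesian_product)
  also have "\<dots> \<le> n * n * card (insert d D)" using insert.hyps by (simp add: mult_ac)
  also have "\<dots> < card T" by fact
  finally have "\<not> T \<subseteq> blocked"
    using card_mono[of blocked T] finX by (auto simp: blocked_def)
  then obtain z where z: "z \<in> T" "z \<notin> blocked" by blast
  have disj: "ap n d z \<inter> X = {}"
  proof (rule ccontr)
    assume "ap n d z \<inter> X \<noteq> {}"
    then obtain i where i: "i < n" "z + i * d \<in> X" by (auto simp: ap_def)
    then have "z = (\<lambda>(x, i). x - i * d) (z + i * d, i)" by simp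
    then have "z \<in> blocked" unfolding blocked_def using i by (intro image_eqI) auto
    with z show False by simp
  qed
  define u where "u = t(d := z)"
  have ud: "u d = z" by (simp add: u_def)
  have uD: "u e = t e" if "e \<in> D" for e using that insert.hyps(2) by (auto simp: u_def)
  have XD: "ap n e (u e) \<subseteq> X" if "e \<in> D" for e using that by (auto simp: X_def uD)
  have "disjoint_family_on (\<lambda>e. ap n e (u e)) (insert d D)"
    unfolding disjoint_family_on_def
  proof (intro ballI impI)
    fix a b assume ab: "a \<in> insert d D" "b \<in> insert d D" "a \<noteq> b"
    consider "a \<in> D" "b \<in> D" | "a = d" "b \<in> D" | "a \<in> D" "b = d" using ab by blast
    then show "ap n a (u a) \<inter> ap n b (u b) = {}"
    proof cases
      case 1 then show ?thesis using t(2) ab(3) by (simp add: uD disjoint_family_on_def)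
    next
      case 2 then show ?thesis using XD[of b] disj by (auto simp: ud)
    next
      case 3 then show ?thesis using XD[of a] disj by (auto simp: ud)
    qed
  qed
  moreover have "\<forall>e\<in>insert d D. ap n e (u e) \<subseteq> F" using t(1) T(2) z by (auto simp: ud uD)
  ultimately show ?case unfolding packable_def by blast
qed

lemma translate_B_eq: "translate t (B n d) = (\<lambda>i. t + int d + int i * int d) ` {..<n}"
proof -
  have "{1..n} = Suc ` {..<n}" by (simp add: image_Suc_lessThan)
  then show ?thesis
    unfolding translate_def B_def by (simp add: image_image algebra_simps)
qed

lemma M_le_if_packable:
  assumes "packable n {1..k} {..<m}" "0 < m"
  shows "M k n \<le> m"
proof -
  obtain t where t: "\<forall>d\<in>{1..k}. ap n d (t d) \<subseteq> {..<m}" "disjoint_family_on (\<lambda>d. ap n d (t d)) {1..k}"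
    using assms(1) unfolding packable_def by blast
  define u where "u d = int (t d) + 1 - int d" for d
  have eq: "translate (u d) (B n d) = (\<lambda>x. int x + 1) ` ap n d (t d)" for d
    unfolding translate_B_eq ap_def u_def by (simp add: image_image algebra_simps)
  have inj: "inj (\<lambda>x. int x + 1)" by (rule injI) simp
  have "packs k n m u"
    unfolding packs_def
  proof
    show "\<forall>d\<in>{1..k}. translate (u d) (B n d) \<subseteq> {1..int m}"
    proof
      fix d assume "d \<in> {1..k}"
      then have "ap n d (t d) \<subseteq> {..<m}" using t(1) by blast
      then show "translate (u d) (B n d) \<subseteq> {1..int m}" unfolding eq by force
    qed
    show "disjoint_family_on (\<lambda>d. translate (u d) (B n d)) {1..k}"
      using t(2) unfolding disjoint_family_on_def eq by (auto simp: image_Int[OF inj, symmetric])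
  qed
  then show ?thesis unfolding M_def using assms(2) by (intro Least_le) auto
qed

lemma M_ge:
  assumes "0 < n" "0 < k"
  shows "n * k \<le> M k n"
proof -
  have "M k n > 0 \<and> (\<exists>t. packs k n (M k n) t)"
    unfolding M_def by (rule LeastI_ex) (use packs_exists[OF assms] in blast)
  then obtain t where t: "packs k n (M k n) t" by blast
  have card: "card (translate (t d) (B n d)) = n" if "d \<in> {1..k}" for d
    unfolding translate_B_eq using that by (subst card_image) (auto simp: inj_on_def)
  have "(\<Union>d\<in>{1..k}. translate (t d) (B n d)) \<subseteq> {1..int (M k n)}"
    using t unfolding packs_def by blast
  then have "card (\<Union>d\<in>{1..k}. translate (t d) (B n d)) \<le> card {1..int (M k n)}"
    by (intro card_mono) auto
  also have "card (\<Union>d\<in>{1..k}. translate (t d) (B n d)) = (\<Sum>d\<in>{1..k}. card (translate (t d) (B n d)))"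
    using t by (intro card_UN_disjoint') (auto simp: packs_def translate_B_eq)
  also have "\<dots> = (\<Sum>d\<in>{1..k}. n)" by (intro sum.cong refl card)
  finally show ?thesis by (simp add: mult.commute)
qed

lemma multiples_card_le:
  assumes "0 < p"
  shows "card {x. x < (m::nat) \<and> p dvd x} \<le> m div p + 1"
proof -
  have "{x. x < m \<and> p dvd x} \<subseteq> (\<lambda>i. p * i) ` {..m div p}"
  proof
    fix x assume "x \<in> {x. x < m \<and> p dvd x}"
    then have "x < m" "x = p * (x div p)" by auto
    moreover have "x div p \<le> m div p" using \<open>x < m\<close> by (intro div_le_mono) auto
    ultimately show "x \<in> (\<lambda>i. p * i) ` {..m div p}" by blast
  qed
  then have "card {x. x < m \<and> p dvd x} \<le> card ((\<lambda>i. p * i) ` {..m div p})" by (intro card_mono) auto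
  also have "\<dots> \<le> m div p + 1" using card_image_le[of "{..m div p}" "\<lambda>i. p * i"] by simp
  finally show ?thesis .
qed

text \<open>By the Chinese remainder theorem there is \<open>t\<close> with \<open>t \<equiv> - i d (mod p i)\<close> for all \<open>i < n\<close>; then the
\<open>i\<close>-th term \<open>t + i d\<close> is a multiple of \<open>p i\<close>. The starts form a residue class modulo the product of the \<open>p i\<close>.\<close>

lemma many_starts_in_multiples:
  fixes p :: "nat \<Rightarrow> nat"
  assumes cop: "\<And>i j. i < n \<Longrightarrow> j < n \<Longrightarrow> i \<noteq> j \<Longrightarrow> coprime (p i) (p j)"
    and pos: "\<And>i. i < n \<Longrightarrow> 0 < p i"
    and n: "0 < n" and d: "d \<le> L"
  shows "\<exists>T. finite T \<and> (\<forall>t\<in>T. ap n d t \<subseteq> {x. x < n * L \<and> (\<exists>i<n. p i dvd x)}) \<and> L div (\<Prod>i<n. p i) \<le> card T"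
proof -
  define P where "P = (\<Prod>i<n. p i)"
  have P: "0 < P" unfolding P_def using pos by (intro prod_pos) auto
  \<comment> \<open>the residue \<open>(p i - 1) i d\<close> is a natural number congruent to \<open>- i d\<close>\<close>
  obtain a where a: "\<forall>i\<in>{..<n}. [a = (p i - 1) * (i * d)] (mod p i)"
    using chinese_remainder_nat[of "{..<n}" p "\<lambda>i. (p i - 1) * (i * d)"] cop by auto
  have dvd_a: "p i dvd a + i * d" if i: "i < n" for i
  proof -
    have "[a + i * d = (p i - 1) * (i * d) + i * d] (mod p i)" using a i by (intro cong_add) auto
    also have "(p i - 1) * (i * d) + i * d = p i * (i * d)"
      using pos[OF i] by (cases "p i") auto
    finally show ?thesis by (simp add: cong_dvd_iff)
  qed
  define T where "T = (\<lambda>l. a mod P + l * P) ` {..<L div P}"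
  have "inj_on (\<lambda>l. a mod P + l * P) {..<L div P}" using P by (auto simp: inj_on_def)
  then have "card T = L div P" unfolding T_def by (simp add: card_image)
  moreover have "ap n d t \<subseteq> {x. x < n * L \<and> (\<exists>i<n. p i dvd x)}" if "t \<in> T" for t
  proof
    fix x assume "x \<in> ap n d t"
    then obtain i where i: "i < n" "x = t + i * d" by (auto simp: ap_def)
    obtain l where l: "l < L div P" "t = a mod P + l * P" using \<open>t \<in> T\<close> by (auto simp: T_def)
    have piP: "p i dvd P" unfolding P_def using i by (intro dvd_prodI) auto
    have "[t = a] (mod P)" unfolding l(2) cong_def by simp
    then have "[t = a] (mod p i)" using piP by (rule cong_dvd_modulus_nat)
    then have "[t + i * d = a + i * d] (mod p i)" by (intro cong_add) auto
    then have "p i dvd x" using dvd_a[OF i(1)] i(2) by (simp add: cong_dvd_iff)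
    moreover have "x < n * L"
    proof -
      have "t < P + l * P" unfolding l(2) using P by simp
      also have "\<dots> = (l + 1) * P" by simp
      also have "\<dots> \<le> (L div P) * P" using l(1) by (intro mult_right_mono) auto
      also have "\<dots> \<le> L" by simp
      finally have "t < L" .
      moreover have "i * d \<le> (n - 1) * L" using i(1) d by (intro mult_mono) auto
      ultimately have "x < L + (n - 1) * L" unfolding i(2) by linarith
      also have "\<dots> = n * L" using n by (cases n) auto
      finally show ?thesis .
    qed
    ultimately show "x \<in> {x. x < n * L \<and> (\<exists>i<n. p i dvd x)}" using i by auto
  qed
  ultimately show ?thesis unfolding P_def[symmetric] by (intro exI[of _ T]) (auto simp: T_def)
qed


section \<open>Interval partitions by stick breaking\<close>

text \<open>Cut \<open>{0..<L}\<close> from the left: the first piece has uniform length in \<open>{1..L}\<close>, the next one uniform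
length in what remains, and so on. A point \<open>s > 0\<close> is a left endpoint with probability
\<open>1 / (L - s + 1)\<close>, and then the piece has each of the \<open>L - s\<close> possible lengths with equal
probability. So \<open>piece_prob L s\<close> is the probability that \<open>{s..<s + d}\<close> is a piece, for every \<open>d \<ge> 1\<close>
with \<open>s + d \<le> L\<close>.\<close>

definition piece_prob :: "nat \<Rightarrow> nat \<Rightarrow> real" where
  "piece_prob L s = (if s = 0 then 1 / real L else 1 / ((real L - real s) * (real L - real s + 1)))"

lemma piece_prob_nonneg: "s \<le> L \<Longrightarrow> 0 \<le> piece_prob L s"
  by (simp add: piece_prob_def)

lemma sum_piece_prob:
  "S < L \<Longrightarrow> (\<Sum>s\<le>S. piece_prob L s) = 1 / (real L - real S)"
proof (induction S)
  case (Suc S)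
  then have "(\<Sum>s\<le>Suc S. piece_prob L s) = 1 / (real L - real S) + piece_prob L (Suc S)" by simp
  also have "\<dots> = 1 / (real L - real (Suc S))"
  proof -
    define x where "x = real L - real (Suc S)"
    have x: "0 < x" "real L - real S = x + 1" using Suc.prems by (auto simp: x_def)
    have "piece_prob L (Suc S) = 1 / (x * (x + 1))" by (simp add: piece_prob_def x_def)
    moreover have "1 / (x + 1) + 1 / (x * (x + 1)) = 1 / x" using x(1) by (simp add: divide_simps)
    ultimately show ?thesis unfolding x(2) x_def[symmetric] by simp
  qed
  finally show ?case .
qed (simp add: piece_prob_def)

lemma sum_UN_le:
  fixes f :: "'a \<Rightarrow> real"
  assumes "finite A" "\<And>x. x \<in> A \<Longrightarrow> finite (S x)" "\<And>x y. x \<in> A \<Longrightarrow> y \<in> S x \<Longrightarrow> 0 \<le> f y"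
  shows "sum f (\<Union>x\<in>A. S x) \<le> (\<Sum>x\<in>A. sum f (S x))"
  using assms
proof (induction A rule: finite_induct)
  case (insert a A)
  have "sum f (S a \<union> (\<Union>x\<in>A. S x)) + sum f (S a \<inter> (\<Union>x\<in>A. S x)) = sum f (S a) + sum f (\<Union>x\<in>A. S x)"
    using insert by (intro sum.union_inter) auto
  moreover have "0 \<le> sum f (S a \<inter> (\<Union>x\<in>A. S x))" using insert.prems by (intro sum_nonneg) auto
  moreover have "sum f (\<Union>x\<in>A. S x) \<le> (\<Sum>x\<in>A. sum f (S x))" using insert by auto
  ultimately show ?case using insert.hyps by simp
qed simp

text \<open>The probability that \<open>y\<close> lies in a piece of length \<open>d\<close>.\<close>

definition cover :: "nat \<Rightarrow> nat \<Rightarrow> nat \<Rightarrow> real" where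
  "cover L d y = (\<Sum>s | s + d \<le> L \<and> s \<le> y \<and> y < s + d. piece_prob L s)"

lemma finite_cover_set [simp]: "finite {s. s + d \<le> L \<and> P s}" for L d :: nat
  by (rule finite_subset[of _ "{..L}"]) auto

lemma sum_piece_prob_total:
  assumes "0 < d" "d \<le> L"
  shows "(\<Sum>s | s + d \<le> L. piece_prob L s) = 1 / real d"
proof -
  have "{s. s + d \<le> L} = {..L - d}" using assms by auto
  then show ?thesis using assms sum_piece_prob[of "L - d" L] by (simp add: of_nat_diff)
qed

lemma cover_le:
  assumes "0 < d" "d \<le> L"
  shows "cover L d y \<le> 1 / real d"
proof -
  have "cover L d y \<le> (\<Sum>s | s + d \<le> L. piece_prob L s)"
    unfolding cover_def using finite_cover_set[of d L "\<lambda>_. True"]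
    by (intro sum_mono2) (auto intro: piece_prob_nonneg)
  then show ?thesis by (simp add: sum_piece_prob_total assms)
qed

text \<open>Over all lengths the sum would be exactly \<open>1\<close>. If \<open>y\<close> is at distance at least \<open>h\<close> from the right
end, at least \<open>h\<close> initial pieces \<open>{0..<d}\<close> that contain \<open>y\<close> have \<open>d > k\<close>, and omitting them saves
\<open>h / L\<close>. Nearer to the right end most of the cover comes from short pieces, and
omitting those of length at most \<open>g\<close> saves one half.\<close>

lemma sum_cover_le:
  assumes y: "y < L" and k: "k + h \<le> L" and g: "g \<le> k" "2 * h \<le> g + 1"
  shows "(\<Sum>d\<in>{g<..k}. cover L d y) \<le> 1 - min (real h / real L) (1 / 2)"
proof -
  define c where "c s = real (card {d. d \<in> {g<..k} \<and> s + d \<le> L \<and> y < s + d})" for s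
  have "(\<Sum>d\<in>{g<..k}. cover L d y) = (\<Sum>d\<in>{g<..k}. \<Sum>s | s \<in> {..y} \<and> (s + d \<le> L \<and> y < s + d). piece_prob L s)"
    unfolding cover_def by (intro sum.cong refl) auto
  also have "\<dots> = (\<Sum>s\<le>y. \<Sum>d | d \<in> {g<..k} \<and> (s + d \<le> L \<and> y < s + d). piece_prob L s)"
    by (rule sum.swap_restrict) auto
  also have "\<dots> = (\<Sum>s\<le>y. c s * piece_prob L s)" by (simp add: c_def)
  finally have eq: "(\<Sum>d\<in>{g<..k}. cover L d y) = (\<Sum>s\<le>y. c s * piece_prob L s)" .
  have c_le: "c s \<le> real L - real y" if "s \<le> y" for s
  proof -
    have "{d. d \<in> {g<..k} \<and> s + d \<le> L \<and> y < s + d} \<subseteq> {y - s<..L - s}" by auto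
    from card_mono[OF _ this] have "card {d. d \<in> {g<..k} \<and> s + d \<le> L \<and> y < s + d} \<le> L - s - (y - s)" by simp
    then show ?thesis unfolding c_def using that y by linarith
  qed
  show ?thesis
  proof (cases "h \<le> L - y")
    case True
    have "c 0 \<le> real L - real y - real h"
    proof -
      have "{d. d \<in> {g<..k} \<and> 0 + d \<le> L \<and> y < 0 + d} \<subseteq> {y<..k}" by auto
      from card_mono[OF _ this] have "card {d. d \<in> {g<..k} \<and> 0 + d \<le> L \<and> y < 0 + d} \<le> k - y" by simp
      then show ?thesis unfolding c_def using True k y by linarith
    qed
    then have "(\<Sum>s\<le>y. c s * piece_prob L s) \<le>
        (\<Sum>s\<le>y. (real L - real y) * piece_prob L s - (if s = 0 then real h * piece_prob L 0 else 0))"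
    proof (intro sum_mono)
      fix s assume c0: "c 0 \<le> real L - real y - real h" and s: "s \<in> {..y}"
      have nn: "0 \<le> piece_prob L s" using s y by (intro piece_prob_nonneg) auto
      show "c s * piece_prob L s \<le> (real L - real y) * piece_prob L s - (if s = 0 then real h * piece_prob L 0 else 0)"
      proof (cases "s = 0")
        case True
        then show ?thesis using mult_right_mono[OF c0 nn] by (simp add: algebra_simps)
      next
        case False
        then show ?thesis using mult_right_mono[OF c_le nn] s by simp
      qed
    qed
    also have "\<dots> = (real L - real y) * (\<Sum>s\<le>y. piece_prob L s) - real h * piece_prob L 0"
      by (simp add: sum_subtractf sum_distrib_left)
    also have "\<dots> = 1 - real h / real L"
      unfolding sum_piece_prob[OF y] using y by (simp add: piece_prob_def)
    finally show ?thesis unfolding eq by linarith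
  next
    case False
    then have hL: "L - y < h" by simp
    have gL: "g < L" using g(1) k hL by linarith
    \<comment> \<open>pieces longer than \<open>g\<close> start before \<open>L - g\<close>\<close>
    have c_zero: "c s = 0" if "L - g \<le> s" for s
    proof -
      have "{d. d \<in> {g<..k} \<and> s + d \<le> L \<and> y < s + d} = {}" using that by auto
      then show ?thesis by (simp add: c_def)
    qed
    have "(\<Sum>s\<le>y. c s * piece_prob L s) \<le> (\<Sum>s\<in>{..y} \<inter> {..L - g - 1}. real h * piece_prob L s)"
    proof -
      have "(\<Sum>s\<le>y. c s * piece_prob L s) = (\<Sum>s\<in>{..y} \<inter> {..L - g - 1}. c s * piece_prob L s)"
        using c_zero by (intro sum.mono_neutral_right) auto
      also have "\<dots> \<le> (\<Sum>s\<in>{..y} \<inter> {..L - g - 1}. real h * piece_prob L s)"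
      proof (intro sum_mono mult_right_mono)
        fix s assume s: "s \<in> {..y} \<inter> {..L - g - 1}"
        show "c s \<le> real h" using c_le[of s] s hL by auto
        show "0 \<le> piece_prob L s" using s by (intro piece_prob_nonneg) auto
      qed
      finally show ?thesis .
    qed
    also have "\<dots> \<le> (\<Sum>s\<le>L - g - 1. real h * piece_prob L s)"
      by (intro sum_mono2) (auto intro!: mult_nonneg_nonneg piece_prob_nonneg)
    also have "\<dots> = real h * (1 / (real g + 1))"
      using gL by (simp add: sum_distrib_left[symmetric] sum_piece_prob of_nat_diff)
    also have "\<dots> \<le> 1 / 2" using g(2) by (simp add: field_simps)
    finally show ?thesis unfolding eq by linarith
  qed
qed

text \<open>The pair \<open>(s, j)\<close> stands for the progression with start \<open>n s + j\<close>, the \<open>j\<close>-th of the \<open>d\<close> progressions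
that tile the scaled piece \<open>{n s..<n (s + d)}\<close>.\<close>

definition starts_through :: "nat \<Rightarrow> nat \<Rightarrow> nat \<Rightarrow> nat \<Rightarrow> (nat \<times> nat) set" where
  "starts_through n L d x = {(s, j). s + d \<le> L \<and> j < d \<and> x \<in> ap n d (n * s + j)}"

lemma finite_block_starts: "finite {(s, j). s + d \<le> L \<and> j < d \<and> Q s j}" for L d :: nat
  by (rule finite_subset[of _ "{..L} \<times> {..<d}"]) auto

lemma ap_in_block:
  assumes x: "x \<in> ap n d (n * s + j)" and j: "j < d"
  shows "n * s \<le> x" "x < n * (s + d)"
proof -
  obtain i where i: "i < n" "x = n * s + j + i * d" using x by (auto simp: ap_def)
  show "n * s \<le> x" using i by simp
  have "j + i * d < (i + 1) * d" using j by simp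
  also have "\<dots> \<le> n * d" using i by (intro mult_right_mono) auto
  finally show "x < n * (s + d)" using i by (simp add: algebra_simps)
qed

text \<open>The \<open>d\<close> progressions in a scaled piece are disjoint, so for each piece at most one of them passes through \<open>x\<close>,
and then the piece covers \<open>x div n\<close>.\<close>

lemma sum_starts_through_le:
  assumes d: "0 < d"
  shows "(\<Sum>(s, j)\<in>starts_through n L d x. piece_prob L s) \<le> cover L d (x div n)"
proof -
  have "inj_on fst (starts_through n L d x)"
  proof (rule inj_onI)
    fix a b assume ab: "a \<in> starts_through n L d x" "b \<in> starts_through n L d x" "fst a = fst b"
    obtain s j s' j' where [simp]: "a = (s, j)" "b = (s', j')" by (cases a; cases b)
    obtain i where i: "x = n * s + j + i * d" and j: "j < d"
      using ab(1) by (auto simp: starts_through_def ap_def)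
    obtain i' where i': "x = n * s + j' + i' * d" and j': "j' < d"
      using ab(2,3) by (auto simp: starts_through_def ap_def)
    have "j + i * d = j' + i' * d" using i i' by simp
    then have "(j + i * d) mod d = (j' + i' * d) mod d" by simp
    then show "a = b" using j j' ab(3) by simp
  qed
  then have "(\<Sum>(s, j)\<in>starts_through n L d x. piece_prob L s) = sum (piece_prob L) (fst ` starts_through n L d x)"
    by (simp add: sum.reindex case_prod_beta o_def)
  also have "\<dots> \<le> cover L d (x div n)"
    unfolding cover_def
  proof (rule sum_mono2)
    show "fst ` starts_through n L d x \<subseteq> {s. s + d \<le> L \<and> s \<le> x div n \<and> x div n < s + d}"
    proof
      fix s assume "s \<in> fst ` starts_through n L d x"
      then obtain j where j: "s + d \<le> L" "j < d" "x \<in> ap n d (n * s + j)"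
        by (auto simp: starts_through_def)
      have n: "0 < n" using j(3) by (auto simp: ap_def)
      note blk = ap_in_block[OF j(3,2)]
      have "s \<le> x div n" using blk(1) n by (metis div_le_mono nonzero_mult_div_cancel_left neq0_conv)
      moreover have "x div n < s + d" using blk(2) n by (simp add: div_less_iff_less_mult mult.commute)
      ultimately show "s \<in> {s. s + d \<le> L \<and> s \<le> x div n \<and> x div n < s + d}" using j by simp
    qed
  qed (auto intro: piece_prob_nonneg)
  finally show ?thesis .
qed

definition free_starts :: "nat \<Rightarrow> nat \<Rightarrow> nat set \<Rightarrow> nat \<Rightarrow> (nat \<times> nat) set" where
  "free_starts n L R d = {(s, j). s + d \<le> L \<and> j < d \<and> ap n d (n * s + j) \<inter> R = {}}"

definition free_mass :: "nat \<Rightarrow> nat \<Rightarrow> nat set \<Rightarrow> nat \<Rightarrow> real" where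
  "free_mass n L R d = (\<Sum>(s, j)\<in>free_starts n L R d. piece_prob L s)"

lemma finite_free_starts [simp]: "finite (free_starts n L R d)"
  unfolding free_starts_def by (rule finite_block_starts)

lemma finite_starts_through [simp]: "finite (starts_through n L d x)"
  unfolding starts_through_def by (rule finite_block_starts)

text \<open>Without \<open>R\<close> the mass would be \<open>d\<close> times the expected number \<open>1 / d\<close> of pieces of length \<open>d\<close>.
Each point of \<open>R\<close> destroys at most the mass that runs through it, which is at most \<open>1 / d\<close>.\<close>

lemma free_mass_ge:
  assumes d: "0 < d" "d \<le> L" and R: "finite R"
  shows "1 - real (card R) / real d \<le> free_mass n L R d"
proof -
  define Al where "Al = {(s, j). s + d \<le> L \<and> j < d}"
  define f where "f = (\<lambda>(s, j::nat). piece_prob L s)"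
  have fin: "finite Al" unfolding Al_def using finite_block_starts[of d L "\<lambda>_ _. True"] by simp
  have f0: "0 \<le> f p" if "p \<in> Al" for p
    using that by (auto simp: f_def Al_def intro: piece_prob_nonneg)
  have "Al = {s. s + d \<le> L} \<times> {..<d}" by (auto simp: Al_def)
  then have "sum f Al = (\<Sum>s | s + d \<le> L. \<Sum>j<d. piece_prob L s)"
    unfolding f_def by (simp only: sum.cartesian_product)
  also have "\<dots> = 1" using d by (simp add: sum_distrib_left[symmetric] sum_piece_prob_total)
  finally have one: "sum f Al = 1" .
  have "sum f Al \<le> sum f (free_starts n L R d \<union> (\<Union>x\<in>R. starts_through n L d x))"
  proof (rule sum_mono2)
    show "finite (free_starts n L R d \<union> (\<Union>x\<in>R. starts_through n L d x))" using R by auto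
  qed (use f0 in \<open>auto simp: free_starts_def starts_through_def Al_def\<close>)
  also have "\<dots> \<le> sum f (free_starts n L R d) + sum f (\<Union>x\<in>R. starts_through n L d x)"
  proof -
    have "0 \<le> sum f (free_starts n L R d \<inter> (\<Union>x\<in>R. starts_through n L d x))"
      by (rule sum_nonneg, rule f0) (auto simp: free_starts_def Al_def)
    moreover have "sum f (free_starts n L R d \<union> (\<Union>x\<in>R. starts_through n L d x)) +
        sum f (free_starts n L R d \<inter> (\<Union>x\<in>R. starts_through n L d x)) =
        sum f (free_starts n L R d) + sum f (\<Union>x\<in>R. starts_through n L d x)"
      using R by (intro sum.union_inter) auto
    ultimately show ?thesis by linarith
  qed
  also have "sum f (\<Union>x\<in>R. starts_through n L d x) \<le> (\<Sum>x\<in>R. sum f (starts_through n L d x))"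
    by (rule sum_UN_le[OF R]) (auto intro!: f0 simp: starts_through_def Al_def intro: finite_block_starts)
  also have "\<dots> \<le> (\<Sum>x\<in>R. 1 / real d)"
    unfolding f_def using sum_starts_through_le[OF d(1)] cover_le[OF d] by (intro sum_mono) (blast intro: order_trans)
  finally show ?thesis using one by (simp add: free_mass_def f_def)
qed

section \<open>The fractional packing as a hypergraph\<close>

text \<open>The differences in \<open>{g<..k}\<close> are to be placed in \<open>{..<n L} - R\<close>. The number \<open>\<sigma>\<close> is the slack of \<open>sum_cover_le\<close>, and
the bound on \<open>card R\<close> says that every difference loses at most the proportion \<open>\<sigma>\<close> of its mass to \<open>R\<close>.\<close>

locale block_layout =
  fixes n k L g h :: nat and R :: "nat set" and \<sigma> :: real
  assumes n: "0 < n" and g: "0 < g" "g \<le> k" "2 * h \<le> g + 1" and k: "k + h \<le> L"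
    and R: "R \<subseteq> {..<n * L}"
    and \<sigma>: "\<sigma> = min (real h / real L) (1 / 2)"
    and card_R: "real (card R) \<le> real g * \<sigma>"
begin

definition vertices :: "(nat + nat) set" where
  "vertices = Inl ` {g<..k} \<union> Inr ` ({..<n * L} - R)"

text \<open>A triple \<open>(d, s, j)\<close> is the placement of difference \<open>d\<close> at \<open>n s + j\<close>. Its weight is normalised so that each
difference has degree \<open>1\<close>. Points have degree at most \<open>1\<close>; a singleton edge \<open>Inr x\<close> makes up
for the deficit.\<close>

definition placements :: "(nat \<times> nat \<times> nat) set" where
  "placements = Sigma {g<..k} (free_starts n L R)"

fun prog :: "nat \<times> nat \<times> nat \<Rightarrow> nat set" where
  "prog (d, s, j) = ap n d (n * s + j)"

fun placement_weight :: "nat \<times> nat \<times> nat \<Rightarrow> real" where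
  "placement_weight (d, s, j) = piece_prob L s / free_mass n L R d"

definition load :: "nat \<Rightarrow> real" where
  "load x = (\<Sum>p | p \<in> placements \<and> x \<in> prog p. placement_weight p)"

definition edges :: "(nat \<times> nat \<times> nat + nat) set" where
  "edges = Inl ` placements \<union> Inr ` ({..<n * L} - R)"

fun edge :: "nat \<times> nat \<times> nat + nat \<Rightarrow> (nat + nat) set" where
  "edge (Inl p) = insert (Inl (fst p)) (Inr ` prog p)"
| "edge (Inr x) = {Inr x}"

fun weight :: "nat \<times> nat \<times> nat + nat \<Rightarrow> real" where
  "weight (Inl p) = placement_weight p"
| "weight (Inr x) = 1 - load x"

lemma finite_R: "finite R"
  using R finite_subset by blast

lemma \<sigma>_bounds: "0 \<le> \<sigma>" "\<sigma> \<le> 1 / 2"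
  unfolding \<sigma> by (simp, rule min.cobounded2)

lemma finite_placements: "finite placements"
  by (simp add: placements_def)

lemma finite_edges: "finite edges"
  by (simp add: edges_def finite_placements)

lemma free_mass_bounds:
  assumes "d \<in> {g<..k}"
  shows "1 - \<sigma> \<le> free_mass n L R d" "1 / 2 \<le> free_mass n L R d"
proof -
  have d: "0 < d" "d \<le> L" "g < d" using assms k by auto
  have "real (card R) \<le> real d * \<sigma>"
    using card_R mult_right_mono[of "real g" "real d" \<sigma>] d \<sigma>_bounds by simp
  then have "real (card R) / real d \<le> \<sigma>" using d by (simp add: field_simps)
  with free_mass_ge[OF d(1,2) finite_R, of n] show "1 - \<sigma> \<le> free_mass n L R d" by linarith
  with \<sigma>_bounds show "1 / 2 \<le> free_mass n L R d" by linarith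
qed

lemma placementsD:
  assumes "(d, s, j) \<in> placements"
  shows "d \<in> {g<..k}" "s + d \<le> L" "j < d" "ap n d (n * s + j) \<inter> R = {}" "s \<le> L"
  using assms by (auto simp: placements_def free_starts_def)

lemma placement_weight_nonneg:
  assumes "p \<in> placements"
  shows "0 \<le> placement_weight p"
proof -
  obtain d s j where [simp]: "p = (d, s, j)" by (cases p)
  note D = placementsD[OF assms[simplified]]
  show ?thesis using free_mass_bounds(2)[OF D(1)] piece_prob_nonneg[OF D(5)] by simp
qed

lemma prog_subset:
  assumes "p \<in> placements"
  shows "prog p \<subseteq> {..<n * L} - R"
proof
  obtain d s j where [simp]: "p = (d, s, j)" by (cases p)
  note D = placementsD[OF assms[simplified]]
  fix x assume "x \<in> prog p"
  then have x: "x \<in> ap n d (n * s + j)" by simp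
  have "x < n * (s + d)" by (rule ap_in_block(2)[OF x D(3)])
  also have "\<dots> \<le> n * L" using D by (intro mult_left_mono) auto
  finally show "x \<in> {..<n * L} - R" using x D(4) by auto
qed

lemma sum_placement_weight_through_le:
  assumes d: "d \<in> {g<..k}" and c: "0 < c" "c \<le> free_mass n L R d"
  shows "(\<Sum>q | q \<in> free_starts n L R d \<and> x \<in> prog (d, q). placement_weight (d, q)) \<le> cover L d (x div n) / c"
proof -
  have "(\<Sum>q | q \<in> free_starts n L R d \<and> x \<in> prog (d, q). placement_weight (d, q)) \<le>
      (\<Sum>q\<in>starts_through n L d x. (case q of (s, j) \<Rightarrow> piece_prob L s) / c)"
  proof (rule order_trans[OF sum_mono sum_mono2])
    show "finite (starts_through n L d x)" by simp
  next
    fix q assume "q \<in> {q. q \<in> free_starts n L R d \<and> x \<in> prog (d, q)}"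
    then show "placement_weight (d, q) \<le> (case q of (s, j) \<Rightarrow> piece_prob L s) / c"
      using c by (cases q) (auto simp: free_starts_def intro!: divide_left_mono piece_prob_nonneg)
  next
    fix q assume "q \<in> starts_through n L d x - {q. q \<in> free_starts n L R d \<and> x \<in> prog (d, q)}"
    then show "0 \<le> (case q of (s, j) \<Rightarrow> piece_prob L s) / c"
      using c by (cases q) (auto simp: starts_through_def intro!: divide_nonneg_nonneg piece_prob_nonneg)
  qed (auto simp: free_starts_def starts_through_def)
  also have "\<dots> = (\<Sum>(s, j)\<in>starts_through n L d x. piece_prob L s) / c"
    by (simp add: sum_divide_distrib)
  also have "\<dots> \<le> cover L d (x div n) / c"
    using sum_starts_through_le[of d L n x] d c by (intro divide_right_mono) auto
  finally show ?thesis .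
qed

lemma sum_placements_filter:
  "(\<Sum>p | p \<in> placements \<and> Q p. placement_weight p) =
     (\<Sum>d\<in>{g<..k}. \<Sum>q | q \<in> free_starts n L R d \<and> Q (d, q). placement_weight (d, q))"
proof -
  have "{p. p \<in> placements \<and> Q p} = Sigma {g<..k} (\<lambda>d. {q. q \<in> free_starts n L R d \<and> Q (d, q)})"
    by (auto simp: placements_def)
  then show ?thesis by (simp add: sum.Sigma)
qed

lemma load_le_1:
  assumes "x < n * L"
  shows "load x \<le> 1"
proof -
  have "load x \<le> (\<Sum>d\<in>{g<..k}. cover L d (x div n) / (1 - \<sigma>))"
    unfolding load_def sum_placements_filter
    using \<sigma>_bounds free_mass_bounds by (intro sum_mono sum_placement_weight_through_le) auto
  also have "\<dots> = (\<Sum>d\<in>{g<..k}. cover L d (x div n)) / (1 - \<sigma>)"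
    by (simp add: sum_divide_distrib)
  also have "\<dots> \<le> (1 - \<sigma>) / (1 - \<sigma>)"
  proof (rule divide_right_mono)
    have "x div n < L" using assms n by (simp add: div_less_iff_less_mult mult.commute)
    then show "(\<Sum>d\<in>{g<..k}. cover L d (x div n)) \<le> 1 - \<sigma>"
      unfolding \<sigma> using k g by (intro sum_cover_le)
  qed (use \<sigma>_bounds in simp)
  also have "\<dots> = 1" using \<sigma>_bounds by simp
  finally show ?thesis .
qed

lemma sum_placement_weight_through_le_const:
  assumes d: "d \<in> {g<..k}"
  shows "(\<Sum>q | q \<in> free_starts n L R d \<and> x \<in> prog (d, q). placement_weight (d, q)) \<le> 2 / real g"
proof -
  have "(\<Sum>q | q \<in> free_starts n L R d \<and> x \<in> prog (d, q). placement_weight (d, q)) \<le> cover L d (x div n) / (1 / 2)"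
    using d free_mass_bounds by (intro sum_placement_weight_through_le) auto
  also have "cover L d (x div n) / (1 / 2) \<le> 2 * (1 / real d)" using cover_le[of d L "x div n"] d k by auto
  also have "\<dots> \<le> 2 / real g" using d g by (simp add: frac_le)
  finally show ?thesis .
qed

lemma sum_weight_eq:
  "(\<Sum>i | i \<in> edges \<and> Q (edge i). weight i) =
     (\<Sum>p | p \<in> placements \<and> Q (edge (Inl p)). placement_weight p) +
     (\<Sum>x | x \<in> {..<n * L} - R \<and> Q {Inr x}. 1 - load x)"
proof -
  have split: "{i. i \<in> edges \<and> Q (edge i)} =
     Inl ` {p. p \<in> placements \<and> Q (edge (Inl p))} \<union> Inr ` {x. x \<in> {..<n * L} - R \<and> Q {Inr x}}"
    by (auto simp: edges_def)
  have "sum weight {i. i \<in> edges \<and> Q (edge i)} = sum weight (Inl ` {p. p \<in> placements \<and> Q (edge (Inl p))}) +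
      sum weight (Inr ` {x. x \<in> {..<n * L} - R \<and> Q {Inr x}})"
    unfolding split using finite_placements by (intro sum.union_disjoint) auto
  then show ?thesis by (simp add: sum.reindex)
qed

text \<open>Two points at distance \<open>m\<close> lie on a common progression only if its difference is \<open>m div i\<close> for some \<open>i < n\<close>, which leaves
at most \<open>n\<close> differences, each of weight at most \<open>2 / g\<close> at a point.\<close>

lemma codeg_points:
  assumes xy: "x \<noteq> y"
  shows "(\<Sum>p | p \<in> placements \<and> x \<in> prog p \<and> y \<in> prog p. placement_weight p) \<le> 2 * real n / real g"
proof -
  define m where "m = (if x < y then y - x else x - y)"
  define Dx where "Dx = {g<..k} \<inter> (\<lambda>i. m div i) ` {..<n}"
  define Sx where "Sx d = {q. q \<in> free_starts n L R d \<and> x \<in> prog (d, q)}" for d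
  have fin: "finite (Sx d)" for d unfolding Sx_def by simp
  have "{p. p \<in> placements \<and> x \<in> prog p \<and> y \<in> prog p} \<subseteq> Sigma Dx Sx"
  proof
    fix p assume p: "p \<in> {p. p \<in> placements \<and> x \<in> prog p \<and> y \<in> prog p}"
    obtain d s j where [simp]: "p = (d, s, j)" by (cases p)
    obtain a b where ab: "a < n" "x = n * s + j + a * d" "b < n" "y = n * s + j + b * d"
      using p by (auto simp: ap_def)
    have d: "d \<in> {g<..k}" using p placementsD(1) by auto
    define i where "i = (if a < b then b - a else a - b)"
    have "m = i * d"
      using ab(2,4) d by (auto simp: m_def i_def diff_mult_distrib)
    moreover have "i \<noteq> 0" using xy ab by (auto simp: i_def)
    ultimately have "d = m div i" by simp
    moreover have "i < n" using ab by (auto simp: i_def)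
    ultimately have "d \<in> Dx" using d by (auto simp: Dx_def)
    then show "p \<in> Sigma Dx Sx" using p by (auto simp: Sx_def placements_def)
  qed
  then have "(\<Sum>p | p \<in> placements \<and> x \<in> prog p \<and> y \<in> prog p. placement_weight p) \<le> sum placement_weight (Sigma Dx Sx)"
    using fin by (intro sum_mono2 placement_weight_nonneg) (auto simp: Dx_def Sx_def placements_def)
  also have "\<dots> = (\<Sum>d\<in>Dx. \<Sum>q\<in>Sx d. placement_weight (d, q))"
    using fin by (subst sum.Sigma) (auto simp: Dx_def)
  also have "\<dots> \<le> (\<Sum>d\<in>Dx. 2 / real g)"
    unfolding Sx_def by (intro sum_mono sum_placement_weight_through_le_const) (auto simp: Dx_def)
  also have "\<dots> \<le> real n * (2 / real g)"
  proof -
    have "card Dx \<le> card ((\<lambda>i. m div i) ` {..<n})" unfolding Dx_def by (intro card_mono) auto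
    also have "\<dots> \<le> n" using card_image_le[of "{..<n}" "\<lambda>i. m div i"] by simp
    finally show ?thesis by (simp add: divide_right_mono)
  qed
  finally show ?thesis by (simp add: mult.commute)
qed

lemma layout_fractional_matching:
  assumes \<kappa>: "2 * real n / real g \<le> \<kappa>"
  shows "fractional_matching vertices edges edge weight (n + 1) \<kappa>"
proof
  show "finite vertices" by (simp add: vertices_def)
  show "finite edges" by (rule finite_edges)
  show "0 \<le> \<kappa>" using \<kappa> by (rule order_trans[rotated]) simp
next
  fix i assume i: "i \<in> edges"
  show "edge i \<subseteq> vertices"
  proof (cases i)
    case (Inl p)
    then have p: "p \<in> placements" using i by (auto simp: edges_def)
    then have "Inl (fst p) \<in> vertices" by (auto simp: placements_def vertices_def)
    moreover have "Inr ` prog p \<subseteq> vertices" using prog_subset[OF p] by (auto simp: vertices_def)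
    ultimately show ?thesis unfolding Inl by simp
  qed (use i in \<open>auto simp: edges_def vertices_def\<close>)
  show "edge i \<noteq> {}" by (cases i) auto
  show "card (edge i) \<le> n + 1"
  proof (cases i)
    case (Inl p)
    obtain d s j where [simp]: "p = (d, s, j)" by (cases p)
    have "card (edge i) \<le> Suc (card (Inr ` prog p :: (nat + nat) set))" unfolding Inl by (simp add: card_insert_if)
    also have "card (Inr ` prog p :: (nat + nat) set) \<le> n" using card_ap_le by (simp add: card_image)
    finally show ?thesis by simp
  qed (use n in simp)
  show "0 \<le> weight i" using i load_le_1 placement_weight_nonneg by (auto simp: edges_def)
next
  fix v assume v: "v \<in> vertices"
  show "(\<Sum>i | i \<in> edges \<and> v \<in> edge i. weight i) = 1"
  proof (cases v)
    case (Inl d)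
    then have d: "d \<in> {g<..k}" using v by (auto simp: vertices_def)
    have "(\<Sum>i | i \<in> edges \<and> v \<in> edge i. weight i) =
        sum placement_weight (Pair d ` free_starts n L R d)"
    proof -
      have "{p. p \<in> placements \<and> v \<in> edge (Inl p)} = Pair d ` free_starts n L R d"
        using d Inl by (auto simp: placements_def)
      moreover have "{x. x \<in> {..<n * L} - R \<and> v \<in> {Inr x}} = {}" using Inl by auto
      ultimately show ?thesis unfolding sum_weight_eq[of "\<lambda>e. v \<in> e"] by (simp only: sum.empty add_0_right)
    qed
    also have "\<dots> = (\<Sum>q\<in>free_starts n L R d. placement_weight (d, q))"
      by (subst sum.reindex) (auto simp: inj_on_def)
    also have "\<dots> = (\<Sum>q\<in>free_starts n L R d. (case q of (s, j) \<Rightarrow> piece_prob L s) / free_mass n L R d)"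
      by (intro sum.cong) auto
    also have "\<dots> = free_mass n L R d / free_mass n L R d"
      unfolding sum_divide_distrib[symmetric] free_mass_def[symmetric] by simp
    also have "\<dots> = 1" using free_mass_bounds(2)[OF d] by auto
    finally show ?thesis .
  next
    case (Inr x)
    then have x: "x \<in> {..<n * L} - R" using v by (auto simp: vertices_def)
    have s: "{y. y \<in> {..<n * L} - R \<and> v \<in> {Inr y}} = {x}" using x Inr by auto
    have "{p. p \<in> placements \<and> v \<in> edge (Inl p)} = {p. p \<in> placements \<and> x \<in> prog p}" using Inr by auto
    then show ?thesis
      unfolding sum_weight_eq[of "\<lambda>e. v \<in> e"] s by (simp add: load_def)
  qed
next
  fix u v assume uv: "u \<in> vertices" "v \<in> vertices" "u \<noteq> v"
  have eq: "(\<Sum>i | i \<in> edges \<and> u \<in> edge i \<and> v \<in> edge i. weight i) =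
      (\<Sum>p | p \<in> placements \<and> u \<in> edge (Inl p) \<and> v \<in> edge (Inl p). placement_weight p)"
  proof -
    have "{x. x \<in> {..<n * L} - R \<and> u \<in> {Inr x} \<and> v \<in> {Inr x}} = {}" using uv(3) by auto
    then show ?thesis unfolding sum_weight_eq[of "\<lambda>e. u \<in> e \<and> v \<in> e"] by (simp only: sum.empty add_0_right)
  qed
  have mixed: "(\<Sum>p | p \<in> placements \<and> fst p = d \<and> x \<in> prog p. placement_weight p) \<le> 2 * real n / real g" if "d \<in> {g<..k}" for d x
  proof -
    have "{p. p \<in> placements \<and> fst p = d \<and> x \<in> prog p} = Pair d ` {q. q \<in> free_starts n L R d \<and> x \<in> prog (d, q)}"
      using that by (auto simp: placements_def)
    then have "sum placement_weight {p. p \<in> placements \<and> fst p = d \<and> x \<in> prog p} =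
        sum placement_weight (Pair d ` {q. q \<in> free_starts n L R d \<and> x \<in> prog (d, q)})" by simp
    also have "\<dots> = (\<Sum>q | q \<in> free_starts n L R d \<and> x \<in> prog (d, q). placement_weight (d, q))"
      by (subst sum.reindex) (auto simp: inj_on_def)
    also have "\<dots> \<le> 2 / real g" by (rule sum_placement_weight_through_le_const[OF that])
    also have "\<dots> \<le> 2 * real n / real g" using n by (intro divide_right_mono) auto
    finally show ?thesis .
  qed
  have "(\<Sum>p | p \<in> placements \<and> u \<in> edge (Inl p) \<and> v \<in> edge (Inl p). placement_weight p) \<le> 2 * real n / real g"
  proof (cases u; cases v)
    fix d d' assume [simp]: "u = Inl d" "v = Inl d'"
    have "{p. p \<in> placements \<and> u \<in> edge (Inl p) \<and> v \<in> edge (Inl p)} = {}" using uv(3) by auto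
    then show ?thesis by (simp only: sum.empty) simp
  next
    fix d x assume [simp]: "u = Inl d" "v = Inr x"
    have "{p. p \<in> placements \<and> u \<in> edge (Inl p) \<and> v \<in> edge (Inl p)} = {p. p \<in> placements \<and> fst p = d \<and> x \<in> prog p}" by auto
    then show ?thesis using mixed[of d x] uv by (simp add: vertices_def image_iff)
  next
    fix d x assume [simp]: "u = Inr x" "v = Inl d"
    have "{p. p \<in> placements \<and> u \<in> edge (Inl p) \<and> v \<in> edge (Inl p)} = {p. p \<in> placements \<and> fst p = d \<and> x \<in> prog p}" by auto
    then show ?thesis using mixed[of d x] uv by (simp add: vertices_def image_iff)
  next
    fix x y assume [simp]: "u = Inr x" "v = Inr y"
    have "{p. p \<in> placements \<and> u \<in> edge (Inl p) \<and> v \<in> edge (Inl p)} = {p. p \<in> placements \<and> x \<in> prog p \<and> y \<in> prog p}" by auto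
    then show ?thesis using codeg_points[of x y] uv(3) by simp
  qed
  then show "(\<Sum>i | i \<in> edges \<and> u \<in> edge i \<and> v \<in> edge i. weight i) \<le> \<kappa>"
    unfolding eq using \<kappa> by linarith
qed

lemma packable_if_matching:
  assumes S: "S \<subseteq> edges" "disjoint_family_on edge S"
    and small: "real (card (vertices - \<Union>(edge ` S))) \<le> \<delta> * real (card vertices)" and \<delta>: "0 \<le> \<delta>"
  shows "\<exists>D\<subseteq>{g<..k}. packable n D ({..<n * L} - R) \<and> real (card ({g<..k} - D)) \<le> \<delta> * real (k + n * L)"
proof -
  define D where "D = {d \<in> {g<..k}. Inl d \<in> \<Union>(edge ` S)}"
  have "\<exists>p. Inl p \<in> S \<and> fst p = d" if "d \<in> D" for d
  proof -
    obtain i where i: "i \<in> S" "Inl d \<in> edge i" using \<open>d \<in> D\<close> by (auto simp: D_def)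
    show ?thesis
    proof (cases i)
      case (Inl p)
      then show ?thesis using i by (intro exI[of _ p]) auto
    qed (use i in auto)
  qed
  then obtain P where P: "\<And>d. d \<in> D \<Longrightarrow> Inl (P d) \<in> S \<and> fst (P d) = d" by metis
  define t where "t d = n * fst (snd (P d)) + snd (snd (P d))" for d
  have ap: "ap n d (t d) = prog (P d)" if "d \<in> D" for d
    using P[OF that] by (cases "P d") (auto simp: t_def)
  have pl: "P d \<in> placements" if "d \<in> D" for d using P[OF that] S(1) by (auto simp: edges_def)
  have "disjoint_family_on (\<lambda>d. ap n d (t d)) D"
    unfolding disjoint_family_on_def
  proof (intro ballI impI)
    fix a b assume ab: "a \<in> D" "b \<in> D" "a \<noteq> b"
    have S': "Inl (P a) \<in> S" "Inl (P b) \<in> S" and "fst (P a) = a" "fst (P b) = b"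
      using P ab by auto
    then have "P a \<noteq> P b" using ab(3) by metis
    then have "edge (Inl (P a)) \<inter> edge (Inl (P b)) = {}"
      using S(2)[unfolded disjoint_family_on_def, rule_format, OF S'] by simp
    then show "ap n a (t a) \<inter> ap n b (t b) = {}" using ab by (auto simp: ap)
  qed
  moreover have "\<forall>d\<in>D. ap n d (t d) \<subseteq> {..<n * L} - R" using prog_subset[OF pl] by (simp add: ap)
  ultimately have "packable n D ({..<n * L} - R)" unfolding packable_def by blast
  moreover have "real (card ({g<..k} - D)) \<le> \<delta> * real (k + n * L)"
  proof -
    have "card ({g<..k} - D) = card (Inl ` ({g<..k} - D) :: (nat + nat) set)" by (simp add: card_image)
    also have "\<dots> \<le> card (vertices - \<Union>(edge ` S))"
      by (intro card_mono) (auto simp: vertices_def D_def)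
    finally have "real (card ({g<..k} - D)) \<le> \<delta> * real (card vertices)" using small by linarith
    also have "card vertices \<le> k + n * L"
    proof -
      have "card vertices \<le> card (Inl ` {g<..k} :: (nat + nat) set) + card (Inr ` ({..<n * L} - R) :: (nat + nat) set)"
        unfolding vertices_def by (rule card_Un_le)
      also have "\<dots> = (k - g) + card ({..<n * L} - R)" by (simp add: card_image)
      also have "\<dots> \<le> k + n * L" using card_mono[of "{..<n * L}" "{..<n * L} - R"] by auto
      finally show ?thesis .
    qed
    then have "real (card vertices) \<le> real (k + n * L)" by (simp only: of_nat_le_iff)
    then have "\<delta> * real (card vertices) \<le> \<delta> * real (k + n * L)" using \<delta> by (intro mult_left_mono)
    finally show ?thesis .
  qed
  ultimately show ?thesis by (intro exI[of _ D]) (auto simp: D_def)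
qed

end


section \<open>Assembling the packing\<close>

lemma exists_large_coprime_family:
  "\<exists>p :: nat \<Rightarrow> nat. (\<forall>i. b < p i) \<and> (\<forall>i j. i \<noteq> j \<longrightarrow> coprime (p i) (p j))"
proof -
  define A where "A = {q::nat. prime q \<and> b < q}"
  have "infinite A"
  proof
    assume "finite A"
    moreover have "{q::nat. prime q} \<subseteq> {..b} \<union> A" by (auto simp: A_def)
    ultimately show False using primes_infinite finite_subset by blast
  qed
  then obtain p :: "nat \<Rightarrow> nat" where p: "inj p" "range p \<subseteq> A"
    using infinite_countable_subset by blast
  show ?thesis
  proof (intro exI[of _ p] conjI allI impI)
    fix i show "b < p i" using p(2) by (auto simp: A_def)
  next
    fix i j :: nat assume "i \<noteq> j"
    then have "p i \<noteq> p j" using p(1) by (auto dest: injD)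
    then show "coprime (p i) (p j)" using p(2) by (auto simp: A_def intro!: primes_coprime)
  qed
qed

lemma packable_small_differences:
  assumes "0 < n" "0 < g"
  shows "packable n {1..g} {n * L..<n * (L + (n * n + 1) * g)}"
proof (rule packable_greedy)
  fix d assume d: "d \<in> {1..g}"
  have "ap n d t \<subseteq> {n * L..<n * (L + (n * n + 1) * g)}" if t: "t \<in> {n * L..<n * L + (n * n + 1) * g}" for t
  proof
    fix x assume "x \<in> ap n d t"
    then obtain i where i: "i < n" "x = t + i * d" by (auto simp: ap_def)
    have "i * d \<le> (n - 1) * ((n * n + 1) * g)" using i(1) d by (intro mult_mono) auto
    moreover have "n * L + (n * n + 1) * g + (n - 1) * ((n * n + 1) * g) = n * (L + (n * n + 1) * g)"
      using assms(1) by (cases n) (auto simp: algebra_simps)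
    ultimately have "x < n * (L + (n * n + 1) * g)" unfolding i(2) using t by auto
    moreover have "n * L \<le> x" unfolding i(2) using t by auto
    ultimately show "x \<in> {n * L..<n * (L + (n * n + 1) * g)}" by simp
  qed
  moreover have "n * n * card {1..g} < card {n * L..<n * L + (n * n + 1) * g}" using assms by simp
  ultimately show "\<exists>T. finite T \<and> (\<forall>t\<in>T. ap n d t \<subseteq> {n * L..<n * (L + (n * n + 1) * g)}) \<and> n * n * card {1..g} < card T"
    by (intro exI[of _ "{n * L..<n * L + (n * n + 1) * g}"]) blast
qed simp

lemma card_union_multiples_le:
  assumes "\<And>i. i < n \<Longrightarrow> b \<le> p i" "0 < b"
  shows "card {x. x < (m::nat) \<and> (\<exists>i<n. p i dvd x)} \<le> n * (m div b + 1)"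
proof -
  have "{x. x < m \<and> (\<exists>i<n. p i dvd x)} = (\<Union>i<n. {x. x < m \<and> p i dvd x})" by auto
  also have "card \<dots> \<le> (\<Sum>i<n. card {x. x < m \<and> p i dvd x})" by (rule card_UN_le) simp
  also have "\<dots> \<le> (\<Sum>i<n. m div b + 1)"
  proof (rule sum_mono)
    fix i assume i: "i \<in> {..<n}"
    have "card {x. x < m \<and> p i dvd x} \<le> m div p i + 1" using assms i by (intro multiples_card_le) (force dest: less_le_trans)
    also have "m div p i \<le> m div b" using assms i by (intro div_le_mono2) auto
    finally show "card {x. x < m \<and> p i dvd x} \<le> m div b + 1" by simp
  qed
  finally show ?thesis by simp
qed

text \<open>The matching places most of \<open>{g<..k}\<close> outside the reserve, the hypothesis \<open>room\<close> lets the greedy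
argument place the others inside it, and \<open>{1..g}\<close> goes to a final segment of length \<open>n (n\<^sup>2 + 1) g\<close>.\<close>

lemma packable_of_layout:
  fixes p :: "nat \<Rightarrow> nat"
  assumes layout: "block_layout n k L g h {x. x < n * L \<and> (\<exists>i<n. p i dvd x)} \<sigma>"
    and cop: "\<And>i j. i < n \<Longrightarrow> j < n \<Longrightarrow> i \<noteq> j \<Longrightarrow> coprime (p i) (p j)"
    and pos: "\<And>i. i < n \<Longrightarrow> 0 < p i"
    and matching: "\<And>V I ed w. fractional_matching (V :: (nat + nat) set) (I :: (nat \<times> nat \<times> nat + nat) set) ed w (n + 1) \<kappa> \<Longrightarrow>
       \<exists>S\<subseteq>I. disjoint_family_on ed S \<and> real (card (V - \<Union>(ed ` S))) \<le> \<delta> * real (card V)"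
    and \<delta>: "0 \<le> \<delta>"
    and \<kappa>: "2 * real n / real g \<le> \<kappa>"
    and room: "real (n * n) * (\<delta> * real (k + n * L)) < real (L div (\<Prod>i<n. p i))"
  shows "packable n {1..k} {..<n * (L + (n * n + 1) * g)}"
proof -
  define R where "R = {x. x < n * L \<and> (\<exists>i<n. p i dvd x)}"
  interpret block_layout n k L g h R \<sigma> using layout unfolding R_def .
  obtain S where "S \<subseteq> edges" "disjoint_family_on edge S"
    "real (card (vertices - \<Union>(edge ` S))) \<le> \<delta> * real (card vertices)"
    using matching[OF layout_fractional_matching[OF \<kappa>]] by blast
  from packable_if_matching[OF this \<delta>] obtain D where
    D: "D \<subseteq> {g<..k}" "packable n D ({..<n * L} - R)" "real (card ({g<..k} - D)) \<le> \<delta> * real (k + n * L)"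
    by blast
  have left: "packable n ({g<..k} - D) R"
  proof (rule packable_greedy)
    fix d assume "d \<in> {g<..k} - D"
    then have "d \<le> L" using k by auto
    from many_starts_in_multiples[of n p, OF cop pos n this] obtain T where
      T: "finite T" "\<forall>t\<in>T. ap n d t \<subseteq> R" "L div (\<Prod>i<n. p i) \<le> card T" unfolding R_def by blast
    have "real (n * n * card ({g<..k} - D)) = real (n * n) * real (card ({g<..k} - D))" by simp
    also have "\<dots> \<le> real (n * n) * (\<delta> * real (k + n * L))" using D(3) by (rule mult_left_mono) simp
    also have "\<dots> < real (L div (\<Prod>i<n. p i))" by (rule room)
    finally have "n * n * card ({g<..k} - D) < L div (\<Prod>i<n. p i)" by (simp only: of_nat_less_iff)
    with T show "\<exists>T. finite T \<and> (\<forall>t\<in>T. ap n d t \<subseteq> R) \<and> n * n * card ({g<..k} - D) < card T"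
      by (intro exI[of _ T]) auto
  qed simp
  have "packable n (D \<union> ({g<..k} - D)) (({..<n * L} - R) \<union> R)"
    by (rule packable_Un[OF D(2) left]) auto
  moreover have "D \<union> ({g<..k} - D) = {g<..k}" using D(1) by auto
  moreover have "({..<n * L} - R) \<union> R = {..<n * L}" using R by auto
  ultimately have "packable n {g<..k} {..<n * L}" by simp
  then have "packable n ({g<..k} \<union> {1..g}) ({..<n * L} \<union> {n * L..<n * (L + (n * n + 1) * g)})"
    using n g by (intro packable_Un packable_small_differences) auto
  moreover have "{g<..k} \<union> {1..g} = {1..k}" using g by auto
  moreover have "{..<n * L} \<union> {n * L..<n * (L + (n * n + 1) * g)} = {..<n * (L + (n * n + 1) * g)}"
    by (auto simp: distrib_left)
  ultimately show ?thesis by simp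
qed

text \<open>The parameters are chosen in the order \<open>\<gamma>, p, \<delta>, \<kappa>\<close>: the threshold \<open>g \<approx> \<gamma> k\<close> leaves room for
the final segment and for the slack within \<open>\<epsilon> k\<close>; the moduli \<open>p i\<close> are so large that \<open>R\<close> is
sparse relative to the slack; and the failure rate \<open>\<delta>\<close> of the matching is small compared with the
density of starts in \<open>R\<close>, the inverse of the product of the \<open>p i\<close>.\<close>

lemma eventually_packable:
  fixes n :: nat and \<epsilon> :: real
  assumes n: "0 < n" and \<epsilon>: "0 < \<epsilon>" "\<epsilon> < 1"
  shows "\<exists>k0>0. \<forall>k\<ge>k0. packable n {1..k} {..<n * nat \<lceil>(1 + \<epsilon>) * real k\<rceil>}"
proof -
  define \<gamma> where "\<gamma> = \<epsilon> / real (n * n + 2)"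
  have denom: "1 \<le> real (n * n + 2)" using of_nat_0_le_iff[of "n * n", where 'a = real] by linarith
  have \<gamma>: "0 < \<gamma>" unfolding \<gamma>_def using \<epsilon> denom by (intro divide_pos_pos) linarith+
  have \<gamma>1: "\<gamma> \<le> 1" unfolding \<gamma>_def using \<epsilon> denom by (subst divide_le_eq_1_pos) linarith+
  have \<gamma>_mult: "real (n * n + 2) * \<gamma> = \<epsilon>"
    unfolding \<gamma>_def times_divide_eq_right using denom by (intro nonzero_mult_div_cancel_left) linarith
  \<comment> \<open>the constant gives \<open>card R \<le> \<gamma>\<^sup>2 k / 24\<close>, while \<open>g \<ge> \<gamma> k / 2\<close> and \<open>\<sigma> \<ge> \<gamma> / 12\<close>\<close>
  define b where "b = nat \<lceil>96 * (real n)\<^sup>2 / \<gamma>\<^sup>2\<rceil> + 1"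
  have b: "96 * (real n)\<^sup>2 / \<gamma>\<^sup>2 \<le> real b" "0 < b" unfolding b_def by linarith+
  obtain p :: "nat \<Rightarrow> nat" where p: "\<And>i. b < p i" "\<And>i j. i \<noteq> j \<Longrightarrow> coprime (p i) (p j)"
    using exists_large_coprime_family[of b] by blast
  have ppos: "0 < p i" for i using p(1)[of i] by linarith
  define P where "P = (\<Prod>i<n. p i)"
  have P: "0 < P" unfolding P_def using ppos by (intro prod_pos) auto
  define \<delta> where "\<delta> = 1 / (4 * real P * real (n * n) * real (2 * n + 1))"
  have \<delta>: "0 < \<delta>" "\<delta> < 1"
  proof -
    have "1 \<le> P" "1 \<le> n * n" "1 \<le> 2 * n + 1" using P n by (auto simp: Suc_le_eq)
    then have "1 \<le> real P" "1 \<le> real (n * n)" "1 \<le> real (2 * n + 1)"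
      by (metis of_nat_1 of_nat_le_iff)+
    then have "1 * 1 * 1 \<le> real P * real (n * n) * real (2 * n + 1)" by (intro mult_mono) auto
    then show "0 < \<delta>" "\<delta> < 1" unfolding \<delta>_def by (auto simp: field_simps)
  qed
  obtain \<kappa> :: real where \<kappa>: "0 < \<kappa>"
    and matching: "\<And>(V :: (nat + nat) set) (I :: (nat \<times> nat \<times> nat + nat) set) ed w. fractional_matching V I ed w (n + 1) \<kappa> \<Longrightarrow>
       \<exists>S\<subseteq>I. disjoint_family_on ed S \<and> real (card (V - \<Union>(ed ` S))) \<le> \<delta> * real (card V)"
    using near_perfect_matching[OF \<delta>, where r = "n + 1"] by blast
  \<comment> \<open>the summands serve, in turn, the lower bounds on \<open>g\<close> and \<open>h\<close>, the bound on \<open>card R\<close>, the codegrees, and the room in \<open>R\<close>\<close>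
  define k0 where "k0 = nat \<lceil>6 / \<gamma>\<rceil> + nat \<lceil>48 * real n / \<gamma>\<^sup>2\<rceil> + nat \<lceil>4 * real n / (\<gamma> * \<kappa>)\<rceil> + 4 * P + 1"
  have "packable n {1..k} {..<n * nat \<lceil>(1 + \<epsilon>) * real k\<rceil>}" if "k0 \<le> k" for k
  proof -
    have "real k0 = real (nat \<lceil>6 / \<gamma>\<rceil>) + real (nat \<lceil>48 * real n / \<gamma>\<^sup>2\<rceil>) +
        real (nat \<lceil>4 * real n / (\<gamma> * \<kappa>)\<rceil>) + 4 * real P + 1"
      by (simp only: k0_def of_nat_add of_nat_mult of_nat_1 of_nat_numeral)
    moreover have "real k0 \<le> real k" using that by simp
    ultimately have k0: "6 / \<gamma> \<le> real k" "48 * real n / \<gamma>\<^sup>2 \<le> real k" "4 * real n / (\<gamma> * \<kappa>) \<le> real k"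
      "4 * real P \<le> real k" "1 \<le> real k"
      using real_nat_ceiling_ge[of "6 / \<gamma>"] real_nat_ceiling_ge[of "48 * real n / \<gamma>\<^sup>2"]
        real_nat_ceiling_ge[of "4 * real n / (\<gamma> * \<kappa>)"] of_nat_0_le_iff[of P, where 'a = real]
        of_nat_0_le_iff[of "nat \<lceil>6 / \<gamma>\<rceil>", where 'a = real] of_nat_0_le_iff[of "nat \<lceil>48 * real n / \<gamma>\<^sup>2\<rceil>", where 'a = real]
        of_nat_0_le_iff[of "nat \<lceil>4 * real n / (\<gamma> * \<kappa>)\<rceil>", where 'a = real]
      by linarith+
    have k0': "6 \<le> \<gamma> * real k" "48 * real n \<le> \<gamma>\<^sup>2 * real k" "4 * real n \<le> \<gamma> * real k * \<kappa>"
      using k0 \<gamma> \<kappa> by (auto simp: field_simps)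
    define g where "g = nat \<lfloor>\<gamma> * real k\<rfloor>"
    have g_le: "real g \<le> \<gamma> * real k" and g_gt: "\<gamma> * real k - 1 < real g"
      unfolding g_def using \<gamma> by (auto simp: of_nat_nat)
    have g_ge: "\<gamma> * real k / 2 \<le> real g" using g_gt k0'(1) by linarith
    have g_pos: "0 < g" using g_ge k0'(1) by (cases "g = 0") auto
    define h where "h = g div 2"
    have h_ge: "\<gamma> * real k / 6 \<le> real h"
    proof -
      have "g \<le> 2 * h + 1" unfolding h_def by linarith
      then have "real g \<le> 2 * real h + 1" by linarith
      then show ?thesis using g_gt k0'(1) by linarith
    qed
    define N where "N = nat \<lceil>(1 + \<epsilon>) * real k\<rceil>"
    have N_ge: "(1 + \<epsilon>) * real k \<le> real N" unfolding N_def by linarith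
    have N_le: "N \<le> 2 * k"
    proof -
      have "(1 + \<epsilon>) * real k \<le> 2 * real k" using \<epsilon> by (intro mult_right_mono) auto
      then have "\<lceil>(1 + \<epsilon>) * real k\<rceil> \<le> int (2 * k)" by (simp add: ceiling_le_iff)
      then show ?thesis unfolding N_def by linarith
    qed
    \<comment> \<open>\<open>(n\<^sup>2 + 1) g\<close> is for the final segment, the remaining \<open>g\<close> makes \<open>L \<ge> k + g\<close>\<close>
    have gk: "(n * n + 2) * g + k \<le> N"
    proof -
      have "real (n * n + 2) * real g \<le> real (n * n + 2) * (\<gamma> * real k)" using g_le by (intro mult_left_mono) auto
      also have "\<dots> = \<epsilon> * real k" by (simp only: mult.assoc[symmetric] \<gamma>_mult)
      finally have "real ((n * n + 2) * g + k) \<le> real N" using N_ge by (simp add: algebra_simps)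
      then show ?thesis by (simp only: of_nat_le_iff)
    qed
    define L where "L = N - (n * n + 1) * g"
    have L: "L + (n * n + 1) * g = N" and Lk: "k + g \<le> L" using gk unfolding L_def by (auto simp: algebra_simps)
    have L2: "L \<le> 2 * k" using N_le unfolding L_def by linarith
    define \<sigma> where "\<sigma> = min (real h / real L) (1 / 2)"
    define R where "R = {x. x < n * L \<and> (\<exists>i<n. p i dvd x)}"
    have Lpos: "0 < real L" "real L \<le> 2 * real k" using Lk g_pos L2 by linarith+
    have \<sigma>_ge: "\<gamma> / 12 \<le> \<sigma>"
    proof -
      have "\<gamma> / 12 * real L \<le> \<gamma> / 12 * (2 * real k)" using Lpos \<gamma> by (intro mult_left_mono) auto
      also have "\<dots> \<le> real h" using h_ge by simp
      finally have "\<gamma> / 12 \<le> real h / real L" using Lpos by (simp add: field_simps)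
      then show ?thesis using \<gamma>1 by (simp add: \<sigma>_def)
    qed
    have "block_layout n k L g h R \<sigma>"
    proof
      show "0 < n" "0 < g" by fact+
      have "\<gamma> * real k \<le> 1 * real k" using \<gamma>1 by (intro mult_right_mono) auto
      then show "g \<le> k" using g_le by linarith
      show "2 * h \<le> g + 1" "k + h \<le> L" using Lk by (auto simp: h_def)
      show "R \<subseteq> {..<n * L}" by (auto simp: R_def)
      show "\<sigma> = min (real h / real L) (1 / 2)" by (rule \<sigma>_def)
      have "card R \<le> n * (n * L div b + 1)" unfolding R_def
        using p(1) b(2) by (intro card_union_multiples_le) (auto intro: less_imp_le)
      then have "real (card R) \<le> real n * (real (n * L div b) + 1)"
        by (metis of_nat_1 of_nat_add of_nat_le_iff of_nat_mult)
      also have "\<dots> \<le> real n * (real (n * L) / real b + 1)"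
        by (intro mult_left_mono add_right_mono of_nat_div_le_of_nat) auto
      also have "\<dots> = real n * real n * real L / real b + real n" by (simp add: algebra_simps)
      also have "real n * real n * real L / real b \<le> \<gamma>\<^sup>2 * real k / 48"
      proof -
        have "96 * (real n)\<^sup>2 \<le> real b * \<gamma>\<^sup>2" using b \<gamma> by (simp add: field_simps)
        then have "96 * (real n)\<^sup>2 * real k \<le> real b * \<gamma>\<^sup>2 * real k" by (intro mult_right_mono) auto
        moreover have "(real n)\<^sup>2 * real L \<le> (real n)\<^sup>2 * (2 * real k)" using Lpos by (intro mult_left_mono) auto
        ultimately show ?thesis using b(2) by (simp add: field_simps power2_eq_square)
      qed
      also have "real n \<le> \<gamma>\<^sup>2 * real k / 48" using k0'(2) by simp
      also have "\<gamma>\<^sup>2 * real k / 48 + \<gamma>\<^sup>2 * real k / 48 = (\<gamma> * real k / 2) * (\<gamma> / 12)"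
        by (simp add: power2_eq_square)
      also have "\<dots> \<le> real g * \<sigma>" using g_ge \<sigma>_ge \<gamma> by (intro mult_mono) auto
      finally show "real (card R) \<le> real g * \<sigma>" by simp
    qed
    moreover have "2 * real n / real g \<le> \<kappa>"
    proof -
      have "2 * real n \<le> \<gamma> * real k / 2 * \<kappa>" using k0'(3) by simp
      also have "\<dots> \<le> real g * \<kappa>" using g_ge \<kappa> by (intro mult_right_mono) auto
      finally show ?thesis using g_pos by (simp add: field_simps)
    qed
    moreover have "real (n * n) * (\<delta> * real (k + n * L)) < real (L div P)"
    proof -
      have "real (k + n * L) \<le> real (2 * n + 1) * real k"
      proof -
        have "n * L \<le> n * (2 * k)" using L2 by (intro mult_left_mono) auto
        then have "k + n * L \<le> (2 * n + 1) * k" by (simp add: algebra_simps)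
        then show ?thesis by (metis of_nat_le_iff of_nat_mult)
      qed
      then have "real (n * n) * (\<delta> * real (k + n * L)) \<le> real (n * n) * (\<delta> * (real (2 * n + 1) * real k))"
        using \<delta> by (intro mult_left_mono) auto
      also have "\<dots> = real k / (4 * real P)" 
      proof -
        have "a * (1 / (4 * p * a * c) * (c * x)) = x / (4 * p)"
          if "a \<noteq> 0" "c \<noteq> 0" "p \<noteq> 0" for a c p x :: real
          using that by (simp add: field_simps)
        moreover have "real (n * n) \<noteq> 0" "real (2 * n + 1) \<noteq> 0" "real P \<noteq> 0"
          using n P by (simp_all only: of_nat_eq_0_iff) auto
        ultimately show ?thesis unfolding \<delta>_def by blast
      qed
      also have "\<dots> < real k / real P - 1" using k0(4) P k0(5) by (simp add: field_simps)
      also have "\<dots> \<le> real L / real P - 1" using Lk by (intro diff_right_mono divide_right_mono) auto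
      also have "\<dots> \<le> real (L div P)"
      proof -
        have "L < (L div P + 1) * P" using P by (metis Suc_eq_plus1 dividend_less_div_times mult_Suc)
        then have "real L < (real (L div P) + 1) * real P" by (metis of_nat_1 of_nat_add of_nat_less_iff of_nat_mult)
        then have "real L / real P < real (L div P) + 1" using P by (simp add: pos_divide_less_eq)
        then show ?thesis by linarith
      qed
      finally show ?thesis .
    qed
    ultimately have "packable n {1..k} {..<n * (L + (n * n + 1) * g)}"
      unfolding R_def P_def using p ppos matching \<delta>
      by (intro packable_of_layout[where p = p and \<kappa> = \<kappa> and \<delta> = \<delta> and h = h and \<sigma> = \<sigma>]) auto
    then show ?thesis unfolding L N_def .
  qed
  moreover have "0 < k0" by (simp add: k0_def)
  ultimately show ?thesis by blast
qed

theorem theorem1p2: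
  fixes n :: nat
  assumes "n > 0"
  shows "(\<forall>\<epsilon>::real. 0 < \<epsilon> \<and> \<epsilon> < 1 \<longrightarrow>
            (\<exists>k0::nat. \<forall>k\<ge>k0. int (M k n) \<le> int n * \<lceil>(1 + \<epsilon>) * real k\<rceil>))
         \<and> (\<lambda>k. real (M k n) / (real n * real k)) \<longlonglongrightarrow> 1"
proof -
  have bound: "\<exists>k0>0. \<forall>k\<ge>k0. int (M k n) \<le> int n * \<lceil>(1 + \<epsilon>) * real k\<rceil>"
    if \<epsilon>: "0 < \<epsilon>" "\<epsilon> < 1" for \<epsilon> :: real
  proof -
    obtain k0 where k0: "0 < k0" "\<And>k. k0 \<le> k \<Longrightarrow> packable n {1..k} {..<n * nat \<lceil>(1 + \<epsilon>) * real k\<rceil>}"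
      using eventually_packable[OF assms \<epsilon>] by blast
    have "int (M k n) \<le> int n * \<lceil>(1 + \<epsilon>) * real k\<rceil>" if k: "k0 \<le> k" for k
    proof -
      have "0 < (1 + \<epsilon>) * real k" using \<epsilon> k k0(1) by simp
      then have pos: "0 < \<lceil>(1 + \<epsilon>) * real k\<rceil>" by simp
      then have "M k n \<le> n * nat \<lceil>(1 + \<epsilon>) * real k\<rceil>"
        using assms by (intro M_le_if_packable k0(2)[OF k]) simp
      then have "int (M k n) \<le> int (n * nat \<lceil>(1 + \<epsilon>) * real k\<rceil>)" by (simp only: of_nat_le_iff)
      with pos show ?thesis by simp
    qed
    then show ?thesis using k0(1) by blast
  qed
  have "(\<lambda>k. real (M k n) / (real n * real k)) \<longlonglongrightarrow> 1"
  proof (rule LIMSEQ_I)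
    fix r :: real assume r: "0 < r"
    define \<epsilon> where "\<epsilon> = min (r / 2) (1 / 2)"
    have \<epsilon>: "0 < \<epsilon>" "\<epsilon> < 1" "\<epsilon> \<le> r / 2" using r by (auto simp: \<epsilon>_def)
    obtain k0 where k0: "0 < k0" "\<And>k. k0 \<le> k \<Longrightarrow> int (M k n) \<le> int n * \<lceil>(1 + \<epsilon>) * real k\<rceil>"
      using bound[OF \<epsilon>(1,2)] by blast
    have "norm (real (M k n) / (real n * real k) - 1) < r" if k: "k0 + nat \<lceil>2 / r\<rceil> + 1 \<le> k" for k
    proof -
      have kpos: "0 < k" using k by simp
      have "2 / r < real k" using k r by linarith
      then have k2: "1 < r / 2 * real k" using r by (simp add: field_simps)
      have nk: "0 < real n * real k" using assms kpos by simp
      have "real_of_int (int (M k n)) \<le> real_of_int (int n * \<lceil>(1 + \<epsilon>) * real k\<rceil>)"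
        using k0(2)[of k] k by (simp only: of_int_le_iff)
      also have "\<dots> = real n * real_of_int \<lceil>(1 + \<epsilon>) * real k\<rceil>" by simp
      also have "\<dots> < real n * ((1 + r) * real k)"
      proof (rule mult_strict_left_mono)
        have "real_of_int \<lceil>(1 + \<epsilon>) * real k\<rceil> < (1 + \<epsilon>) * real k + 1" by linarith
        also have "\<epsilon> * real k \<le> r / 2 * real k" using \<epsilon>(3) by (intro mult_right_mono) auto
        then have "(1 + \<epsilon>) * real k + 1 < (1 + r) * real k" using k2 by (simp add: algebra_simps)
        finally show "real_of_int \<lceil>(1 + \<epsilon>) * real k\<rceil> < (1 + r) * real k" .
      qed (use assms in simp)
      finally have up: "real (M k n) / (real n * real k) < 1 + r" using nk by (simp add: field_simps)
      have "real (n * k) \<le> real (M k n)" using M_ge[OF assms kpos] by (simp only: of_nat_le_iff)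
      then have "1 \<le> real (M k n) / (real n * real k)" using nk by (simp add: field_simps)
      with up show ?thesis by simp
    qed
    then show "\<exists>no. \<forall>k\<ge>no. norm (real (M k n) / (real n * real k) - 1) < r" by blast
  qed
  with bound show ?thesis by blast
qed

end
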